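(* Let $(d,h)$ be a minimal higher matrix factorization with respect to a regular sequence $f_1,\dots,f_c$ in a local ring $S$, let $M$ be its HMF module, and let $n=\sum_p\operatorname{rank}B_0(p)$ be the rank of the target of $d$. In a suitable basis, the minimal presentation matrix of $M$ as an $S$-module consists of the matrix of $d$ concatenated with an $\big(n\times\sum_p(p-1)\operatorname{rank}B_0(p)\big)$-matrix that is the direct sum, over $p=1,\dots,c$, of the matrices $$\begin{pmatrix}f_1&\cdots&f_{p-1}\end{pmatrix}\otimes\mathrm{Id}_{B_0(p)},$$ i.e. block matrices with $\operatorname{rank}B_0(p)$ rows, the $i$-th row having the entries $f_1,\dots,f_{p-1}$ in the $i$-th group of $p-1$ columns and zeros elsewhere.
   Context: All rings are commutative and Noetherian, all modules finitely generated. For elements $f_1,\dots,f_c$ of a ring $S$ put $R=S/(f_1,\dots,f_c)$. A higher matrix factorization (HMF) $(d,h)$ with respect to $f_1,\dots,f_c$ consists of: (1) finitely generated free $S$-modules $A_0,A_1$ with filtrations $0=A_s(0)\subseteq A_s(1)\subseteq\cdots\subseteq A_s(c)=A_s$ ($s=0,1$) such that each $A_s(p-1)$ is a free summand of $A_s(p)$; (2) $S$-linear maps $d:A_1\to A_0$ and $h:\bigoplus_{q=1}^cA_0(q)\to A_1$ preserving filtrations, where $\bigoplus_qA_0(q)$ is filtered by the submodules $\bigoplus_{q\le p}A_0(q)$; such that, writing $d_p:A_1(p)\to A_0(p)$ and $h_p:A_0(p)\to A_1(p)$ for the induced maps ($h_p$ is the restriction of $h$ to the $p$-th summand), $B_s(p)=A_s(p)/A_s(p-1)$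 (free modules), and $\pi_p:A_1(p)\to B_1(p)$ for the projection, one has for all $1\le p\le c$: (a) $d_ph_p\equiv f_p\,\mathrm{Id}_{A_0(p)}$ modulo $(f_1,\dots,f_{p-1})A_0(p)$; (b) $\pi_ph_pd_p\equiv f_p\,\pi_p$ modulo $(f_1,\dots,f_{p-1})B_1(p)$. The HMF module of $(d,h)$ is $M=\operatorname{coker}(R\otimes_S d)$. $(d,h)$ is minimal if the images of $d$ and $h$ are contained in the maximal ideal times their targets. *)

theory Defs
  imports
    "Jordan_Normal_Form.VS_Connect"
    "HOL-Algebra.QuotRing"
    "HOL-Algebra.Ring_Divisibility"
begin

hide_const (open) Multiset.mult Polynomial.smult

text \<open>
  The base ring \<open>S\<close> is a type of class \<^class>\<open>comm_ring_1\<close>, seen as the structure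
  \<^term>\<open>class_ring\<close>, so that matrices and vectors over it are available; modules over \<open>S\<close>
  are \<^typ>\<open>('a, 'b) module\<close> records with explicit carriers.  Sequences \<open>f\<^sub>1, \<dots>, f\<^sub>c\<close> are
  functions on \<^typ>\<open>nat\<close> of which only the values at \<open>1, \<dots>, c\<close> matter.
\<close>

abbreviation Smodule :: "('a::comm_ring_1, 'b) module \<Rightarrow> bool"
  where "Smodule M \<equiv> Module.module class_ring M"

abbreviation Ssubmodule :: "'b set \<Rightarrow> ('a::comm_ring_1, 'b) module \<Rightarrow> bool"
  where "Ssubmodule N M \<equiv> LinearCombinations.submodule class_ring N M"

abbreviation Shom :: "('a::comm_ring_1, 'b) module \<Rightarrow> ('a, 'c) module \<Rightarrow> ('b \<Rightarrow> 'c) set"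
  where "Shom M N \<equiv> LinearCombinations.module_hom class_ring M N"

abbreviation submod :: "('a::comm_ring_1, 'b) module \<Rightarrow> 'b set \<Rightarrow> ('a, 'b) module"
  where "submod M N \<equiv> M\<lparr>carrier := N\<rparr>"


subsection \<open>Local rings and regular sequences\<close>

definition noetherian_local_ring :: "('a, 'r) ring_scheme \<Rightarrow> bool" where
  "noetherian_local_ring R \<longleftrightarrow>
     cring R \<and> noetherian_ring R \<and> (\<exists>!I. maximalideal I R)"

definition max_ideal :: "('a::comm_ring_1) set" where
  "max_ideal = (THE I. maximalideal I (class_ring :: 'a ring))"

definition seq_ideal :: "(nat \<Rightarrow> 'a::comm_ring_1) \<Rightarrow> nat \<Rightarrow> 'a set" where
  "seq_ideal f p = Idl\<^bsub>class_ring\<^esub> (f ` {1..p})"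

definition regular_sequence :: "(nat \<Rightarrow> 'a::comm_ring_1) \<Rightarrow> nat \<Rightarrow> bool" where
  "regular_sequence f c \<longleftrightarrow>
     (\<forall>p\<in>{1..c}. let I = seq_ideal f (p - 1); Q = class_ring Quot I in
        \<forall>X\<in>carrier Q. (I +>\<^bsub>class_ring\<^esub> f p) \<otimes>\<^bsub>Q\<^esub> X = \<zero>\<^bsub>Q\<^esub> \<longrightarrow> X = \<zero>\<^bsub>Q\<^esub>) \<and>
     seq_ideal f c \<noteq> UNIV"


subsection \<open>Quotients, bases and ranks of modules\<close>

text \<open>As for the additive groups of rings, the elements of \<open>M/N\<close> are cosets; the fields
  \<^const>\<open>mult\<close> and \<^const>\<open>one\<close> of a module record are not part of the module structure.\<close>

definition quot_module :: "('a::comm_ring_1, 'b) module \<Rightarrow> 'b set \<Rightarrow> ('a, 'b set) module" where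
  "quot_module M N =
     \<lparr>carrier = a_rcosets\<^bsub>M\<^esub> N, mult = undefined, one = undefined, zero = N, add = set_add M,
      smult = (\<lambda>a X. \<Union>x\<in>X. N +>\<^bsub>M\<^esub> (a \<odot>\<^bsub>M\<^esub> x))\<rparr>"

text \<open>The submodule \<open>IM\<close>.\<close>

definition ideal_mod :: "'a::comm_ring_1 set \<Rightarrow> ('a, 'b) module \<Rightarrow> 'b set" where
  "ideal_mod I M =
     LinearCombinations.module.span class_ring M {a \<odot>\<^bsub>M\<^esub> x | a x. a \<in> I \<and> x \<in> carrier M}"

definition ordered_basis :: "('a::comm_ring_1, 'b) module \<Rightarrow> 'b list \<Rightarrow> bool" where
  "ordered_basis M xs \<longleftrightarrow>
     set xs \<subseteq> carrier M \<and> distinct xs \<and>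
     \<not> LinearCombinations.module.lin_dep class_ring M (set xs) \<and>
     LinearCombinations.module.span class_ring M (set xs) = carrier M"

definition fg_free_module :: "('a::comm_ring_1, 'b) module \<Rightarrow> bool" where
  "fg_free_module M \<longleftrightarrow> Smodule M \<and> (\<exists>xs. ordered_basis M xs)"

text \<open>Over a (nonzero) commutative ring all bases of a free module have the same length, so
  taking the least one is no restriction.\<close>

definition free_rank :: "('a::comm_ring_1, 'b) module \<Rightarrow> nat" where
  "free_rank M = (LEAST n. \<exists>xs. ordered_basis M xs \<and> length xs = n)"

text \<open>\<open>D\<close> is the matrix of \<open>g\<close>; its columns are the coordinates of the images of the basis
  elements \<open>xs\<close> of the source.\<close>

definition matrix_of_hom ::
  "('a::comm_ring_1, 'c) module \<Rightarrow> 'b list \<Rightarrow> 'c list \<Rightarrow> ('b \<Rightarrow> 'c) \<Rightarrow> 'a mat \<Rightarrow> bool" where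
  "matrix_of_hom N xs ys g D \<longleftrightarrow>
     D \<in> carrier_mat (length ys) (length xs) \<and>
     (\<forall>j<length xs. g (xs ! j) = (\<Oplus>\<^bsub>N\<^esub>i\<in>{..<length ys}. (D $$ (i, j)) \<odot>\<^bsub>N\<^esub> (ys ! i)))"


subsection \<open>Filtered free modules\<close>

definition graded_piece ::
  "('a::comm_ring_1, 'b) module \<Rightarrow> (nat \<Rightarrow> 'b set) \<Rightarrow> nat \<Rightarrow> ('a, 'b set) module" where
  "graded_piece M F p = quot_module (submod M (F p)) (F (p - 1))"

definition free_filtration ::
  "nat \<Rightarrow> ('a::comm_ring_1, 'b) module \<Rightarrow> (nat \<Rightarrow> 'b set) \<Rightarrow> bool" where
  "free_filtration c M F \<longleftrightarrow>
     fg_free_module M \<and> F 0 = {\<zero>\<^bsub>M\<^esub>} \<and> F c = carrier M \<and>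
     (\<forall>p\<le>c. Ssubmodule (F p) M) \<and>
     (\<forall>p\<in>{1..c}.
        fg_free_module (submod M (F (p - 1))) \<and>
        (\<exists>C. Ssubmodule C M \<and> F (p - 1) \<inter> C = {\<zero>\<^bsub>M\<^esub>} \<and> F (p - 1) <+>\<^bsub>M\<^esub> C = F p) \<and>
        fg_free_module (graded_piece M F p))"

text \<open>The external direct sum \<open>F(1) \<oplus> \<dots> \<oplus> F(p)\<close>, as tuples indexed by \<open>1, \<dots>, p\<close>; the padding
  with zeros makes it a submodule of \<open>F(1) \<oplus> \<dots> \<oplus> F(c)\<close> for \<open>p \<le> c\<close>.\<close>

definition filtered_sum ::
  "('a::comm_ring_1, 'b) module \<Rightarrow> (nat \<Rightarrow> 'b set) \<Rightarrow> nat \<Rightarrow> ('a, nat \<Rightarrow> 'b) module" where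
  "filtered_sum M F p =
     \<lparr>carrier = {x. (\<forall>q\<in>{1..p}. x q \<in> F q) \<and> (\<forall>q. q \<notin> {1..p} \<longrightarrow> x q = \<zero>\<^bsub>M\<^esub>)},
      mult = undefined, one = undefined, zero = (\<lambda>q. \<zero>\<^bsub>M\<^esub>),
      add = (\<lambda>x y q. x q \<oplus>\<^bsub>M\<^esub> y q), smult = (\<lambda>a x q. a \<odot>\<^bsub>M\<^esub> x q)\<rparr>"

text \<open>A basis that starts, for every \<open>p\<close>, with a basis of \<open>F(p)\<close>; its \<open>p\<close>-th group of elements
  therefore lifts a basis of \<open>F(p)/F(p-1)\<close>.\<close>

definition adapted_basis ::
  "nat \<Rightarrow> ('a::comm_ring_1, 'b) module \<Rightarrow> (nat \<Rightarrow> 'b set) \<Rightarrow> 'b list \<Rightarrow> bool" where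
  "adapted_basis c M F xs \<longleftrightarrow>
     ordered_basis M xs \<and> length xs = (\<Sum>p=1..c. free_rank (graded_piece M F p)) \<and>
     (\<forall>p\<le>c. ordered_basis (submod M (F p))
               (take (\<Sum>q=1..p. free_rank (graded_piece M F q)) xs))"


subsection \<open>Higher matrix factorizations\<close>

locale higher_matrix_factorization =
  fixes f :: "nat \<Rightarrow> 'a::comm_ring_1" and c :: nat
    and A0 :: "('a, 'b) module" and F0 :: "nat \<Rightarrow> 'b set"
    and A1 :: "('a, 'c) module" and F1 :: "nat \<Rightarrow> 'c set"
    and d :: "'c \<Rightarrow> 'b" and h :: "(nat \<Rightarrow> 'b) \<Rightarrow> 'c"
  assumes filtration0: "free_filtration c A0 F0"
    and filtration1: "free_filtration c A1 F1"
    and d_hom: "d \<in> Shom A1 A0"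
    and h_hom: "h \<in> Shom (filtered_sum A0 F0 c) A1"
    and d_filtered: "\<And>p. p \<le> c \<Longrightarrow> d ` F1 p \<subseteq> F0 p"
    and h_filtered: "\<And>p. p \<le> c \<Longrightarrow> h ` carrier (filtered_sum A0 F0 p) \<subseteq> F1 p"
    \<comment> \<open>the tuple \<open>\<lambda>q. if q = p then x else 0\<close> is \<open>x\<close> in the \<open>p\<close>-th summand, so its image is \<open>h\<^sub>p x\<close>\<close>
    and d_h: "\<And>p x. \<lbrakk>1 \<le> p; p \<le> c; x \<in> F0 p\<rbrakk> \<Longrightarrow>
        d (h (\<lambda>q. if q = p then x else \<zero>\<^bsub>A0\<^esub>)) \<ominus>\<^bsub>A0\<^esub> (f p \<odot>\<^bsub>A0\<^esub> x)
          \<in> ideal_mod (seq_ideal f (p - 1)) (submod A0 (F0 p))"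
    and h_d: "\<And>p x. \<lbrakk>1 \<le> p; p \<le> c; x \<in> F1 p\<rbrakk> \<Longrightarrow>
        (F1 (p - 1) +>\<^bsub>A1\<^esub> h (\<lambda>q. if q = p then d x else \<zero>\<^bsub>A0\<^esub>))
          \<ominus>\<^bsub>graded_piece A1 F1 p\<^esub>
        (f p \<odot>\<^bsub>graded_piece A1 F1 p\<^esub> (F1 (p - 1) +>\<^bsub>A1\<^esub> x))
          \<in> ideal_mod (seq_ideal f (p - 1)) (graded_piece A1 F1 p)"

definition minimal_hmf ::
  "nat \<Rightarrow> ('a::comm_ring_1, 'b) module \<Rightarrow> (nat \<Rightarrow> 'b set) \<Rightarrow> ('a, 'c) module \<Rightarrow>
   ('c \<Rightarrow> 'b) \<Rightarrow> ((nat \<Rightarrow> 'b) \<Rightarrow> 'c) \<Rightarrow> bool" where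
  "minimal_hmf c A0 F0 A1 d h \<longleftrightarrow>
     d ` carrier A1 \<subseteq> ideal_mod max_ideal A0 \<and>
     h ` carrier (filtered_sum A0 F0 c) \<subseteq> ideal_mod max_ideal A1"

text \<open>For \<open>R = S/I\<close>, the module \<open>R \<otimes>\<^sub>S M\<close> is \<open>M/IM\<close>, and \<open>R \<otimes>\<^sub>S g\<close> is the map induced
  by \<open>g\<close> on the quotients.\<close>

definition base_change :: "'a::comm_ring_1 set \<Rightarrow> ('a, 'b) module \<Rightarrow> ('a, 'b set) module" where
  "base_change I M = quot_module M (ideal_mod I M)"

definition base_change_map ::
  "'a::comm_ring_1 set \<Rightarrow> ('a, 'c) module \<Rightarrow> ('b \<Rightarrow> 'c) \<Rightarrow> 'b set \<Rightarrow> 'c set" where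
  "base_change_map I N g X = (\<Union>x\<in>X. ideal_mod I N +>\<^bsub>N\<^esub> g x)"

definition coker_module ::
  "('a::comm_ring_1, 'b) module \<Rightarrow> ('a, 'c) module \<Rightarrow> ('b \<Rightarrow> 'c) \<Rightarrow> ('a, 'c set) module" where
  "coker_module M N g = quot_module N (g ` carrier M)"

text \<open>The HMF module is an \<open>R\<close>-module; only its \<open>S\<close>-module structure is recorded.\<close>

definition hmf_module ::
  "(nat \<Rightarrow> 'a::comm_ring_1) \<Rightarrow> nat \<Rightarrow> ('a, 'b) module \<Rightarrow> ('a, 'c) module \<Rightarrow> ('c \<Rightarrow> 'b) \<Rightarrow>
   ('a, 'b set set) module" where
  "hmf_module f c A0 A1 d =
     (let I = seq_ideal f c
      in coker_module (base_change I A1) (base_change I A0) (base_change_map I A0 d))"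


subsection \<open>Presentation matrices\<close>

text \<open>\<open>P\<close> presents \<open>M\<close> if there is an exact sequence \<open>S\<^sup>m \<rightarrow> S\<^sup>n \<rightarrow> M \<rightarrow> 0\<close> with first map \<open>P\<close>.\<close>

definition presentation_matrix :: "'a::comm_ring_1 mat \<Rightarrow> ('a, 'b) module \<Rightarrow> bool" where
  "presentation_matrix P M \<longleftrightarrow>
     (\<exists>\<epsilon>\<in>Shom (module_vec TYPE('a) (dim_row P)) M.
        \<epsilon> ` carrier_vec (dim_row P) = carrier M \<and>
        {v \<in> carrier_vec (dim_row P). \<epsilon> v = \<zero>\<^bsub>M\<^esub>} = (\<lambda>w. P *\<^sub>v w) ` carrier_vec (dim_col P))"

text \<open>Over a local ring with maximal ideal \<open>\<mm>\<close>, a presentation is minimal if it is the beginning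
  of a minimal free resolution: the image of \<open>S\<^sup>m \<rightarrow> S\<^sup>n\<close> lies in \<open>\<mm>S\<^sup>n\<close>, and so does its kernel
  (the image of the next map of the resolution) in \<open>\<mm>S\<^sup>m\<close>.\<close>

definition minimal_presentation_matrix :: "'a::comm_ring_1 mat \<Rightarrow> ('a, 'b) module \<Rightarrow> bool" where
  "minimal_presentation_matrix P M \<longleftrightarrow>
     presentation_matrix P M \<and>
     (\<forall>w\<in>carrier_vec (dim_col P).
        P *\<^sub>v w \<in> ideal_mod max_ideal (module_vec TYPE('a) (dim_row P)) \<and>
        (P *\<^sub>v w = 0\<^sub>v (dim_row P) \<longrightarrow>
           w \<in> ideal_mod max_ideal (module_vec TYPE('a) (dim_col P))))"

text \<open>The block \<open>(f\<^sub>1 \<dots> f\<^sub>p\<^sub>-\<^sub>1) \<otimes> Id\<close> with \<open>r\<close> rows: row \<open>i\<close> has \<open>f\<^sub>1, \<dots>, f\<^sub>p\<^sub>-\<^sub>1\<close> in its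
  \<open>i\<close>-th group of \<open>p - 1\<close> columns.  Rows and columns are numbered from 0.\<close>

definition koszul_block :: "(nat \<Rightarrow> 'a::comm_ring_1) \<Rightarrow> nat \<Rightarrow> nat \<Rightarrow> 'a mat" where
  "koszul_block f p r =
     mat r (r * (p - 1)) (\<lambda>(i, j). if j div (p - 1) = i then f (j mod (p - 1) + 1) else 0)"

definition concat_cols :: "'a mat \<Rightarrow> 'a mat \<Rightarrow> 'a mat" where
  "concat_cols A B = mat (dim_row A) (dim_col A + dim_col B)
     (\<lambda>(i, j). if j < dim_col A then A $$ (i, j) else B $$ (i, j - dim_col A))"

end

theory Submission
  imports Defs
begin

text \<open>Let \<open>B\<^sub>0(p)\<close> be the span of the \<open>p\<close>-th group of an adapted basis of \<open>A\<^sub>0\<close>, and let \<open>\<mm>\<close> be the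
  maximal ideal.  The columns of the matrix to the right of that of \<open>d\<close> are the elements \<open>f\<^sub>j e\<close>
  with \<open>e\<close> a basis element of \<open>B\<^sub>0(p)\<close> and \<open>j < p\<close>.  Two things have to be shown.

  The columns generate \<open>d(A\<^sub>1) + (f\<^sub>1, \<dots>, f\<^sub>c)A\<^sub>0\<close>, the kernel of \<open>A\<^sub>0 \<rightarrow> M\<close>.  What is missing
  among the generators are the \<open>f\<^sub>q x\<close> with \<open>x \<in> A\<^sub>0(q)\<close>; but \<open>f\<^sub>q x \<equiv> d(h\<^sub>q x)\<close> modulo
  \<open>(f\<^sub>1, \<dots>, f\<^sub>q\<^sub>-\<^sub>1)A\<^sub>0(q)\<close> by condition (a), so induction on \<open>q\<close> yields them
  (\<open>presented_generator\<close>).  This rewriting is linear and stays inside the levels of the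
  filtration: if \<open>x\<close> has coordinates in \<open>\<mm>\<close>, then \<open>f\<^sub>q x\<close> is a combination of the columns with
  coefficients in \<open>\<mm>\<close>.

  Every relation \<open>d(a) + \<Sum> f\<^sub>j \<beta>\<^sub>j = 0\<close> between the columns has its coefficients in \<open>\<mm>\<close>
  (\<open>kernel_coefficients\<close>).  Suppose that \<open>a \<in> A\<^sub>1(p)\<close> and that only blocks up to \<open>p\<close> occur.  Then
  \<open>d(a)\<close> vanishes modulo \<open>(f\<^sub>1, \<dots>, f\<^sub>p\<^sub>-\<^sub>1)\<close>, so condition (b) gives \<open>f\<^sub>p a \<equiv> 0\<close> in \<open>B\<^sub>1(p)\<close> modulo
  this ideal, and \<open>f\<^sub>p\<close> cancels: the top part of \<open>a\<close> is \<open>\<Sum> f\<^sub>j u\<^sub>j\<close> with \<open>j < p\<close>.  The \<open>B\<^sub>0(p)\<close>-part of the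
  relation becomes \<open>\<Sum> f\<^sub>j (d(u\<^sub>j) + \<beta>\<^sub>j) = 0\<close>, and the coefficients of a syzygy of a regular sequence
  lie in the ideal of the sequence (\<open>regular_syzygy_coefficients\<close>); as \<open>d(u\<^sub>j)\<close> has
  coordinates in \<open>\<mm>\<close> by minimality, so has the top part of \<open>\<beta>\<^sub>j\<close>.  The remaining terms \<open>f\<^sub>j d(u\<^sub>j)\<close>
  on \<open>A\<^sub>0(p-1)\<close> are combinations of the columns of the lower levels with coefficients in \<open>\<mm>\<close>, by the
  first part, and induction on \<open>p\<close> applies to what is left.

  The argument is carried out on coordinate families indexed by natural numbers
  (\<open>coordinate_hmf\<close>).  The adapted bases come from bases of least length of the graded pieces: their
  lengths are the ranks by definition, and lifts of them form bases of the \<open>A\<^sub>s(p)\<close>.\<close>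

section \<open>Ideals generated by a regular sequence\<close>

lemma class_ideal_closed:
  fixes J :: "'a::comm_ring_1 set"
  assumes "ideal J (class_ring :: 'a ring)"
  shows "0 \<in> J" and "\<And>x y. x \<in> J \<Longrightarrow> y \<in> J \<Longrightarrow> x + y \<in> J" and "\<And>a x. x \<in> J \<Longrightarrow> a * x \<in> J"
    and "\<And>a x. x \<in> J \<Longrightarrow> x * a \<in> J"
    and "\<And>x. x \<in> J \<Longrightarrow> - x \<in> J" and "\<And>x y. x \<in> J \<Longrightarrow> y \<in> J \<Longrightarrow> x - y \<in> J"
    and "\<And>A g. (\<And>k. k \<in> A \<Longrightarrow> g k \<in> J) \<Longrightarrow> sum g A \<in> J"
proof -
  interpret ideal J "class_ring :: 'a ring" by fact
  show 0: "0 \<in> J" using zero_closed by simp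
  show add: "\<And>x y. x \<in> J \<Longrightarrow> y \<in> J \<Longrightarrow> x + y \<in> J" using a_closed by simp
  show mul: "\<And>a x. x \<in> J \<Longrightarrow> a * x \<in> J" using I_l_closed by simp
  show "\<And>a x. x \<in> J \<Longrightarrow> x * a \<in> J" using I_r_closed by simp
  show neg: "- x \<in> J" if "x \<in> J" for x using mul[OF that, of "-1"] by simp
  show "x - y \<in> J" if "x \<in> J" "y \<in> J" for x y using add[OF that(1) neg[OF that(2)]] by simp
  show "sum g A \<in> J" if "\<And>k. k \<in> A \<Longrightarrow> g k \<in> J" for g and A :: "'x set"
    using that by (induction A rule: infinite_finite_induct) (auto intro: 0 add)
qed

lemma class_idealI:
  fixes J :: "'a::comm_ring_1 set"
  assumes "0 \<in> J" and "\<And>x y. x \<in> J \<Longrightarrow> y \<in> J \<Longrightarrow> x + y \<in> J" and "\<And>a x. x \<in> J \<Longrightarrow> a * x \<in> J"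
  shows "ideal J (class_ring :: 'a ring)"
proof (rule idealI)
  show "ring (class_ring :: 'a ring)" by (rule class_ring.ring_axioms)
  have neg: "- x \<in> J" if "x \<in> J" for x using assms(3)[OF that, of "-1"] by simp
  have inv0: "a_inv class_ring x = - x" for x :: 'a by (simp add: class_ring_simps)
  have inv: "inv\<^bsub>add_monoid class_ring\<^esub> x = - x" for x :: 'a
    using inv0 unfolding a_inv_def .
  show "subgroup J (add_monoid (class_ring :: 'a ring))"
    by (rule subgroup.intro) (auto simp: assms inv0[unfolded a_inv_def, simplified] neg)
qed (use assms(3) in \<open>auto simp: mult.commute\<close>)

lemma UNIV_ideal: "ideal (UNIV :: 'a::comm_ring_1 set) (class_ring :: 'a ring)"
  by (rule class_idealI) auto

lemma seq_ideal_ideal: "ideal (seq_ideal f p) (class_ring :: 'a::comm_ring_1 ring)"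
  unfolding seq_ideal_def by (rule ring.genideal_ideal[OF class_ring.ring_axioms]) simp

lemma seq_ideal_generator:
  fixes f :: "nat \<Rightarrow> 'a::comm_ring_1"
  assumes "j \<in> {1..p}"
  shows "f j \<in> seq_ideal f p"
  using ring.genideal_self[OF class_ring.ring_axioms, of "f ` {1..p}"] assms unfolding seq_ideal_def by auto

lemma seq_ideal_least:
  fixes f :: "nat \<Rightarrow> 'a::comm_ring_1"
  assumes "ideal J (class_ring :: 'a ring)" and "\<And>j. j \<in> {1..p} \<Longrightarrow> f j \<in> J"
  shows "seq_ideal f p \<subseteq> J"
  unfolding seq_ideal_def by (rule ring.genideal_minimal[OF class_ring.ring_axioms assms(1)]) (use assms(2) in auto)

lemma seq_ideal_iff:
  fixes f :: "nat \<Rightarrow> 'a::comm_ring_1"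
  shows "x \<in> seq_ideal f p \<longleftrightarrow> (\<exists>t. x = (\<Sum>j=1..p. f j * t j))"
proof
  let ?J = "{x. \<exists>t. x = (\<Sum>j=1..p. f j * t j)}"
  have "ideal ?J (class_ring :: 'a ring)"
  proof (rule class_idealI)
    show "0 \<in> ?J" by (auto intro: exI[of _ "\<lambda>_. 0"])
    show "x + y \<in> ?J" if xy: "x \<in> ?J" "y \<in> ?J" for x y
    proof -
      obtain t where "x = (\<Sum>j=1..p. f j * t j)" using xy(1) by (elim CollectE exE)
      moreover obtain s where "y = (\<Sum>j=1..p. f j * s j)" using xy(2) by (elim CollectE exE)
      ultimately show ?thesis
        by (auto intro!: exI[of _ "\<lambda>j. t j + s j"] simp: distrib_left sum.distrib)
    qed
    show "a * x \<in> ?J" if x: "x \<in> ?J" for a x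
    proof -
      obtain t where "x = (\<Sum>j=1..p. f j * t j)" using x by (elim CollectE exE)
      then show ?thesis
        by (auto intro!: exI[of _ "\<lambda>j. a * t j"] simp: sum_distrib_left mult_ac)
    qed
  qed
  moreover have "f q \<in> ?J" if "q \<in> {1..p}" for q
  proof -
    have "f q = (\<Sum>j=1..p. f j * (if j = q then 1 else 0))"
      using that by (simp add: if_distrib sum.delta cong: if_cong)
    then show ?thesis by (intro CollectI exI[of _ "\<lambda>j. if j = q then 1 else 0"])
  qed
  ultimately have "seq_ideal f p \<subseteq> ?J" by (rule seq_ideal_least)
  then show "x \<in> seq_ideal f p \<Longrightarrow> \<exists>t. x = (\<Sum>j=1..p. f j * t j)" by blast
next
  assume "\<exists>t. x = (\<Sum>j=1..p. f j * t j)"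
  then obtain t where x: "x = (\<Sum>j=1..p. f j * t j)" by blast
  show "x \<in> seq_ideal f p"
    unfolding x
    by (intro class_ideal_closed(7)[OF seq_ideal_ideal] class_ideal_closed(4)[OF seq_ideal_ideal]
        seq_ideal_generator)
qed

lemma seq_ideal_mono:
  fixes f :: "nat \<Rightarrow> 'a::comm_ring_1"
  assumes "p \<le> q" shows "seq_ideal f p \<subseteq> seq_ideal f q"
  by (rule seq_ideal_least[OF seq_ideal_ideal]) (use assms in \<open>auto intro!: seq_ideal_generator\<close>)

text \<open>The nonzerodivisor condition of a regular sequence, on elements instead of residue classes.\<close>

definition weakly_regular :: "(nat \<Rightarrow> 'a::comm_ring_1) \<Rightarrow> nat \<Rightarrow> bool" where
  "weakly_regular f c \<longleftrightarrow>
     (\<forall>p\<in>{1..c}. \<forall>x. f p * x \<in> seq_ideal f (p - 1) \<longrightarrow> x \<in> seq_ideal f (p - 1))"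

text \<open>The vanishing of the first Koszul homology, by induction on the length: \<open>f\<^sub>p\<close> is a nonzerodivisor
  modulo the ideal of its predecessors, so \<open>v\<^sub>p = \<Sum>\<^sub>j\<^sub><\<^sub>p f\<^sub>j t\<^sub>j\<close>, and substituting this gives the
  shorter syzygy with coefficients \<open>v\<^sub>j + f\<^sub>p t\<^sub>j\<close>.\<close>

lemma regular_syzygy_coefficients:
  fixes f :: "nat \<Rightarrow> 'a::comm_ring_1"
  assumes "weakly_regular f c" and "p \<le> c" and "(\<Sum>j=1..p. f j * v j) = 0" and "j \<in> {1..p}"
  shows "v j \<in> seq_ideal f p"
  using assms(2-4)
proof (induction p arbitrary: v j)
  case 0
  then show ?case by simp
next
  case (Suc p)
  have *: "f (Suc p) * v (Suc p) = - (\<Sum>j=1..p. f j * v j)"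
    using Suc.prems(2) by (simp add: eq_neg_iff_add_eq_0 add.commute)
  have "(\<Sum>j=1..p. f j * v j) \<in> seq_ideal f p" by (auto simp: seq_ideal_iff)
  then have "f (Suc p) * v (Suc p) \<in> seq_ideal f p"
    unfolding * by (rule class_ideal_closed(5)[OF seq_ideal_ideal])
  then have top: "v (Suc p) \<in> seq_ideal f p"
    using assms(1) Suc.prems(1) unfolding weakly_regular_def by (metis Suc_diff_1 Suc_leI atLeastAtMost_iff diff_Suc_1 le_add1 plus_1_eq_Suc zero_less_Suc)
  then obtain t where t: "v (Suc p) = (\<Sum>j=1..p. f j * t j)" by (auto simp: seq_ideal_iff)
  have "(\<Sum>j=1..p. f j * (v j + f (Suc p) * t j)) = 0"
    using Suc.prems(2) by (simp add: t distrib_left sum.distrib sum_distrib_left mult_ac)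
  from Suc.IH[OF _ this] Suc.prems(1)
  have low: "v j + f (Suc p) * t j \<in> seq_ideal f p" if "j \<in> {1..p}" for j using that by auto
  show ?case
  proof (cases "j = Suc p")
    case True
    then show ?thesis using top seq_ideal_mono[of p "Suc p" f] by auto
  next
    case False
    then have "j \<in> {1..p}" using Suc.prems(3) by auto
    then have 1: "v j + f (Suc p) * t j \<in> seq_ideal f (Suc p)"
      using low seq_ideal_mono[of p "Suc p" f] by auto
    have 2: "f (Suc p) * t j \<in> seq_ideal f (Suc p)"
      by (intro class_ideal_closed(4)[OF seq_ideal_ideal] seq_ideal_generator) simp
    show ?thesis using class_ideal_closed(6)[OF seq_ideal_ideal 1 2] by simp
  qed
qed

lemma regular_sequence_imp_weakly_regular:
  fixes f :: "nat \<Rightarrow> 'a::comm_ring_1"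
  assumes "regular_sequence f c"
  shows "weakly_regular f c"
  unfolding weakly_regular_def
proof (intro ballI allI impI)
  fix p x
  assume p: "p \<in> {1..c}" and fx: "f p * x \<in> seq_ideal f (p - 1)"
  let ?I = "seq_ideal f (p - 1)" and ?R = "class_ring :: 'a ring"
  interpret I: ideal ?I ?R by (rule seq_ideal_ideal)
  have "(?I +>\<^bsub>?R\<^esub> f p) \<otimes>\<^bsub>?R Quot ?I\<^esub> (?I +>\<^bsub>?R\<^esub> x) = ?I +>\<^bsub>?R\<^esub> (f p * x)"
    using I.rcoset_mult_add[of "f p" x] by (simp add: FactRing_def)
  also have "\<dots> = \<zero>\<^bsub>?R Quot ?I\<^esub>"
    using I.a_rcos_const[OF fx] by (simp add: FactRing_def)
  finally have "?I +>\<^bsub>?R\<^esub> x = \<zero>\<^bsub>?R Quot ?I\<^esub>"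
    using assms p abelian_group.a_rcosetsI[OF class_ring.abelian_group_axioms I.a_subset, of x] unfolding regular_sequence_def Let_def
    by (auto simp: FactRing_def)
  then show "x \<in> ?I"
    using I.a_rcos_self[of x] by (simp add: FactRing_def)
qed

text \<open>A proper ideal lies in a maximal one by Zorn's lemma, where the chain condition of a Noetherian ring
  keeps unions of chains proper; over a local ring there is only one maximal ideal to lie in.\<close>

lemma local_ring_max_ideal:
  fixes J :: "'a::comm_ring_1 set"
  assumes "noetherian_local_ring (class_ring :: 'a ring)"
  shows "ideal (max_ideal :: 'a set) (class_ring :: 'a ring)"
    and "ideal J (class_ring :: 'a ring) \<Longrightarrow> J \<noteq> UNIV \<Longrightarrow> J \<subseteq> max_ideal"
proof -
  let ?R = "class_ring :: 'a ring"
  have ex1: "\<exists>!I. maximalideal I ?R" and noeth: "noetherian_ring ?R"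
    using assms unfolding noetherian_local_ring_def by auto
  have max: "maximalideal (max_ideal :: 'a set) ?R"
    unfolding max_ideal_def by (rule theI'[OF ex1])
  then show "ideal (max_ideal :: 'a set) ?R" by (rule maximalideal.axioms(1))
  assume J: "ideal J ?R" "J \<noteq> UNIV"
  let ?A = "{I. ideal I ?R \<and> J \<subseteq> I \<and> I \<noteq> UNIV}"
  have "\<exists>M\<in>?A. \<forall>X\<in>?A. M \<subseteq> X \<longrightarrow> X = M"
  proof (rule subset_Zorn_nonempty)
    show "?A \<noteq> {}" using J by auto
    fix C assume C: "C \<noteq> {}" "subset.chain ?A C"
    then have "subset.chain {I. ideal I ?R} C" unfolding pred_on.chain_def by blast
    from noetherian_ring.ideal_chain_is_trivial[OF noeth C(1) this] C(2)
    show "\<Union>C \<in> ?A" unfolding pred_on.chain_def by blast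
  qed
  then obtain M where M: "M \<in> ?A" "\<forall>X\<in>?A. M \<subseteq> X \<longrightarrow> X = M" by blast
  have "maximalideal M ?R"
  proof (rule maximalidealI)
    show "ideal M ?R" "carrier ?R \<noteq> M" using M(1) by auto
    show "K = M \<or> K = carrier ?R" if "ideal K ?R" "M \<subseteq> K" "K \<subseteq> carrier ?R" for K
      using that M by auto
  qed
  then show "J \<subseteq> max_ideal" using ex1 max M(1) by auto
qed

section \<open>Higher matrix factorizations in coordinates\<close>

text \<open>\<open>N0 p\<close> and \<open>N1 p\<close> are the ranks of \<open>A\<^sub>0(p)\<close> and \<open>A\<^sub>1(p)\<close>, so membership in these submodules means
  vanishing from index \<open>N0 p\<close> or \<open>N1 p\<close> on, and \<open>D\<close> is the matrix of \<open>d\<close>.  The map \<open>h\<close> enters through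
  \<open>D_h\<close> and \<open>h_D\<close>, which are what conditions (a) and (b) say about \<open>d\<close> in coordinates.\<close>

locale coordinate_hmf =
  fixes f :: "nat \<Rightarrow> 'a::comm_ring_1" and c :: nat and N0 N1 :: "nat \<Rightarrow> nat"
    and D :: "nat \<Rightarrow> nat \<Rightarrow> 'a"
  assumes regular: "weakly_regular f c"
    and N0_0: "N0 0 = 0" and N1_0: "N1 0 = 0" and mono_N0: "mono N0" and mono_N1: "mono N1"
    and D_filtered: "\<And>p i k. p \<le> c \<Longrightarrow> k < N1 p \<Longrightarrow> N0 p \<le> i \<Longrightarrow> D i k = 0"
    and D_h: "\<And>p x. p \<in> {1..c} \<Longrightarrow> (\<forall>i\<ge>N0 p. x i = 0) \<Longrightarrow>
       \<exists>z. (\<forall>k\<ge>N1 p. z k = 0) \<and>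
           (\<forall>i. (\<Sum>k<N1 c. D i k * z k) - f p * x i \<in> seq_ideal f (p - 1))"
    and h_D: "\<And>p a k. p \<in> {1..c} \<Longrightarrow> (\<forall>k\<ge>N1 p. a k = 0) \<Longrightarrow>
       (\<forall>i. (\<Sum>k<N1 c. D i k * a k) \<in> seq_ideal f (p - 1)) \<Longrightarrow> N1 (p - 1) \<le> k \<Longrightarrow> k < N1 p \<Longrightarrow>
       f p * a k \<in> seq_ideal f (p - 1)"
begin

definition Dmap :: "(nat \<Rightarrow> 'a) \<Rightarrow> nat \<Rightarrow> 'a" where
  "Dmap a i = (\<Sum>k<N1 c. D i k * a k)"

text \<open>The map given by the Koszul blocks.  The coefficient of \<open>f\<^sub>j\<close> in row \<open>i\<close> is \<open>\<beta> i j\<close>, so that columns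
  are numbered by pairs \<open>(i, j)\<close>.\<close>

definition Kmap :: "(nat \<Rightarrow> nat \<Rightarrow> 'a) \<Rightarrow> nat \<Rightarrow> 'a" where
  "Kmap \<beta> i = (\<Sum>j=1..c. f j * \<beta> i j)"

text \<open>Row \<open>i\<close> lies in a block with \<open>p > j\<close> exactly if \<open>i \<ge> N0 j\<close>; therefore the support condition on \<open>\<beta>\<close>
  says that only columns of the blocks up to \<open>p\<close> are used.\<close>

definition level_coeffs :: "nat \<Rightarrow> 'a set \<Rightarrow> (nat \<Rightarrow> 'a) \<Rightarrow> (nat \<Rightarrow> nat \<Rightarrow> 'a) \<Rightarrow> bool" where
  "level_coeffs p J a \<beta> \<longleftrightarrow>
     (\<forall>k. a k \<in> J) \<and> (\<forall>k\<ge>N1 p. a k = 0) \<and>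
     (\<forall>i j. \<beta> i j \<in> J) \<and> (\<forall>i j. \<beta> i j \<noteq> 0 \<longrightarrow> 1 \<le> j \<and> N0 j \<le> i \<and> i < N0 p)"

text \<open>The full ring as \<open>J\<close> expresses that the columns generate; the maximal ideal as \<open>J\<close> is what minimality
  is about.\<close>

definition presented :: "nat \<Rightarrow> 'a set \<Rightarrow> (nat \<Rightarrow> 'a) \<Rightarrow> bool" where
  "presented p J y \<longleftrightarrow> (\<exists>a \<beta>. level_coeffs p J a \<beta> \<and> (\<forall>i. y i = Dmap a i + Kmap \<beta> i))"

lemma Dmap_add: "Dmap (\<lambda>k. a k + b k) i = Dmap a i + Dmap b i"
  by (simp add: Dmap_def distrib_left sum.distrib)

lemma Dmap_smult: "Dmap (\<lambda>k. s * a k) i = s * Dmap a i"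
  by (simp add: Dmap_def sum_distrib_left mult_ac)

lemma Dmap_sum: "Dmap (\<lambda>k. \<Sum>j\<in>A. g j k) i = (\<Sum>j\<in>A. Dmap (g j) i)"
  by (induction A rule: infinite_finite_induct) (auto simp: Dmap_add, simp_all add: Dmap_def)

lemma Kmap_add: "Kmap (\<lambda>i j. a i j + b i j) i = Kmap a i + Kmap b i"
  by (simp add: Kmap_def distrib_left sum.distrib)

lemma Kmap_smult: "Kmap (\<lambda>i j. s * a i j) i = s * Kmap a i"
  by (simp add: Kmap_def sum_distrib_left mult_ac)

lemma Dmap_below:
  assumes "p \<le> c" and "\<forall>k\<ge>N1 p. a k = 0" and "N0 p \<le> i"
  shows "Dmap a i = 0"
  unfolding Dmap_def using assms D_filtered by (intro sum.neutral) (metis mult_zero_left mult_zero_right not_le)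

lemma level_coeffs_add:
  assumes "ideal J (class_ring :: 'a ring)" "level_coeffs p J a \<beta>" "level_coeffs p J a' \<beta>'"
  shows "level_coeffs p J (\<lambda>k. a k + a' k) (\<lambda>i j. \<beta> i j + \<beta>' i j)"
  using assms(2,3) class_ideal_closed(2)[OF assms(1)] unfolding level_coeffs_def
  by (metis add.right_neutral)

lemma presented_zero:
  assumes "ideal J (class_ring :: 'a ring)" shows "presented p J (\<lambda>_. 0)"
  unfolding presented_def level_coeffs_def using class_ideal_closed(1)[OF assms]
  by (intro exI[of _ "\<lambda>_. 0"] exI[of _ "\<lambda>_ _. 0"]) (auto simp: Dmap_def Kmap_def)

lemma presented_add:
  assumes "ideal J (class_ring :: 'a ring)" "presented p J y" "presented p J z"
  shows "presented p J (\<lambda>i. y i + z i)"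
proof -
  obtain a b a' b' where 1: "level_coeffs p J a b" "\<forall>i. y i = Dmap a i + Kmap b i"
    and 2: "level_coeffs p J a' b'" "\<forall>i. z i = Dmap a' i + Kmap b' i"
    using assms(2,3) unfolding presented_def by blast
  show ?thesis unfolding presented_def
    using level_coeffs_add[OF assms(1) 1(1) 2(1)] 1(2) 2(2)
    by (intro exI[of _ "\<lambda>k. a k + a' k"] exI[of _ "\<lambda>i j. b i j + b' i j"])
       (simp add: Dmap_add Kmap_add algebra_simps)
qed

lemma presented_sum:
  assumes "ideal J (class_ring :: 'a ring)" "\<And>j. j \<in> A \<Longrightarrow> presented p J (y j)"
  shows "presented p J (\<lambda>i. \<Sum>j\<in>A. y j i)"
  using assms(2)
  by (induction A rule: infinite_finite_induct)
     (auto simp: presented_zero[OF assms(1)] intro!: presented_add[OF assms(1)])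

lemma presented_smult:
  assumes "ideal J (class_ring :: 'a ring)" "presented p UNIV y" "s \<in> J"
  shows "presented p J (\<lambda>i. s * y i)"
proof -
  obtain a b where 1: "level_coeffs p UNIV a b" "\<forall>i. y i = Dmap a i + Kmap b i"
    using assms(2) unfolding presented_def by blast
  have "level_coeffs p J (\<lambda>k. s * a k) (\<lambda>i j. s * b i j)"
    using 1(1) class_ideal_closed(4)[OF assms(1,3)] unfolding level_coeffs_def
    by (metis mult_zero_right)
  then show ?thesis unfolding presented_def
    using 1(2) by (intro exI[of _ "\<lambda>k. s * a k"] exI[of _ "\<lambda>i j. s * b i j"])
       (simp add: Dmap_smult Kmap_smult algebra_simps)
qed

text \<open>Split \<open>x\<close> at \<open>N0 q\<close>.  On the rows from \<open>N0 q\<close> on, \<open>f\<^sub>q\<close> is itself an entry of the Koszul blocks.  The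
  part in \<open>A\<^sub>0(q)\<close> is, after multiplication with \<open>f\<^sub>q\<close>, in the image of \<open>d\<close> up to multiples of
  \<open>f\<^sub>1, \<dots>, f\<^sub>q\<^sub>-\<^sub>1\<close>, for which the claim is known.\<close>

lemma presented_generator_UNIV:
  assumes "1 \<le> q" "q \<le> p" "p \<le> c" "\<forall>i\<ge>N0 p. x i = 0"
  shows "presented p UNIV (\<lambda>i. f q * x i)"
  using assms(1,2,4)
proof (induction q arbitrary: x rule: less_induct)
  case (less q)
  define x' x'' where "x' i = (if i < N0 q then x i else 0)" and "x'' i = (if i < N0 q then 0 else x i)" for i
  have split: "f q * x i = f q * x' i + f q * x'' i" for i by (simp add: x'_def x''_def)
  have N: "N1 q \<le> N1 p" "N0 q \<le> N0 p" using less.prems mono_N1 mono_N0 by (auto dest: monoD)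
  have "presented p UNIV (\<lambda>i. f q * x'' i)"
    unfolding presented_def
  proof (intro exI conjI allI)
    let ?b = "\<lambda>i j. if j = q then x'' i else 0"
    show "level_coeffs p UNIV (\<lambda>_. 0) ?b"
      unfolding level_coeffs_def using less.prems by (auto simp: x''_def not_le[symmetric])
    show "f q * x'' i = Dmap (\<lambda>_. 0) i + Kmap ?b i" for i
      using less.prems assms(3) by (simp add: Dmap_def Kmap_def if_distrib sum.delta cong: if_cong)
  qed
  moreover have "presented p UNIV (\<lambda>i. f q * x' i)"
  proof -
    have q: "q \<in> {1..c}" using less.prems assms(3) by auto
    obtain z where z: "\<forall>k\<ge>N1 q. z k = 0"
      and "\<forall>i. (\<Sum>k<N1 c. D i k * z k) - f q * x' i \<in> seq_ideal f (q - 1)"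
      using D_h[OF q, of x'] by (auto simp: x'_def)
    then have "\<exists>t. \<forall>i. Dmap z i - f q * x' i = (\<Sum>j=1..q-1. f j * t i j)"
      by (auto simp: seq_ideal_iff Dmap_def intro!: choice)
    then obtain t where t: "\<And>i. Dmap z i - f q * x' i = (\<Sum>j=1..q-1. f j * t i j)" by blast
    define t' where "t' j i = (if i < N0 q then - t i j else 0)" for i j
    have eq: "f q * x' i = Dmap z i + (\<Sum>j=1..q-1. f j * t' j i)" for i
    proof (cases "i < N0 q")
      case True
      have "f q * x' i = Dmap z i - (\<Sum>j=1..q-1. f j * t i j)" 
        using t[of i] by (simp only: algebra_simps)
      then show ?thesis using True by (simp add: t'_def sum_negf)
    next
      case False
      then have "Dmap z i = 0" using q z by (intro Dmap_below[of q]) auto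
      then show ?thesis using False by (simp add: x'_def t'_def)
    qed
    have 1: "presented p UNIV (Dmap z)"
      unfolding presented_def level_coeffs_def
      by (intro exI[of _ z] exI[of _ "\<lambda>_ _. 0"]) (use N z in \<open>auto simp: Kmap_def\<close>)
    have 2: "presented p UNIV (\<lambda>i. \<Sum>j=1..q-1. f j * t' j i)"
    proof (rule presented_sum[OF UNIV_ideal])
      fix j assume "j \<in> {1..q-1}"
      then show "presented p UNIV (\<lambda>i. f j * t' j i)"
        using less.prems N by (intro less.IH) (auto simp: t'_def)
    qed
    show ?thesis unfolding eq by (rule presented_add[OF UNIV_ideal 1 2])
  qed
  ultimately show ?case unfolding split by (intro presented_add[OF UNIV_ideal])
qed

text \<open>The coefficients inherit the ideal of the coordinates of \<open>x\<close>, because \<open>x\<close> can be expanded in unit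
  vectors, to which the previous lemma applies.\<close>

lemma presented_generator:
  assumes J: "ideal J (class_ring :: 'a ring)"
    and "1 \<le> q" "q \<le> p" "p \<le> c" "\<forall>i\<ge>N0 p. x i = 0" "\<forall>i. x i \<in> J"
  shows "presented p J (\<lambda>i. f q * x i)"
proof -
  define e :: "nat \<Rightarrow> nat \<Rightarrow> 'a" where "e l i = (if i = l then 1 else 0)" for l i
  have "presented p J (\<lambda>i. \<Sum>l<N0 p. x l * (f q * e l i))"
    by (intro presented_sum[OF J] presented_smult[OF J] presented_generator_UNIV)
       (use assms in \<open>auto simp: e_def\<close>)
  moreover have "(\<Sum>l<N0 p. x l * (f q * e l i)) = f q * x i" for i
    using assms(5) by (simp add: e_def if_distrib sum.delta' mult.commute not_le[symmetric] cong: if_cong)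
  ultimately show ?thesis by simp
qed

text \<open>In the induction on the level, the parts of \<open>a\<close> and
  \<open>\<beta>\<close> of level exactly \<open>p + 1\<close> are controlled by regularity, and the rest of the relation is moved to
  level \<open>p\<close> by changing the coefficients only by elements of \<open>J\<close>.\<close>

lemma kernel_coefficients:
  assumes J: "ideal J (class_ring :: 'a ring)" and fJ: "\<And>j. j \<in> {1..c} \<Longrightarrow> f j \<in> J"
    and DJ: "\<And>i k. k < N1 c \<Longrightarrow> D i k \<in> J"
    and "p \<le> c" and "level_coeffs p UNIV a \<beta>" and "\<And>i. Dmap a i + Kmap \<beta> i = 0"
  shows "level_coeffs p J a \<beta>"
  using assms(4-6)
proof (induction p arbitrary: a \<beta>)
  case 0
  then show ?case using class_ideal_closed(1)[OF J] N0_0 N1_0 unfolding level_coeffs_def by auto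
next
  case (Suc p)
  note Jc = class_ideal_closed[OF J]
  note Ic = class_ideal_closed[OF seq_ideal_ideal[of f p]]
  let ?I = "seq_ideal f p"
  have IJ: "?I \<subseteq> J" by (rule seq_ideal_least[OF J]) (use Suc.prems(1) fJ in auto)
  have DmapJ: "Dmap b i \<in> J" for b i
    unfolding Dmap_def by (intro Jc(7) Jc(4) DJ) auto
  have a0: "\<forall>k\<ge>N1 (Suc p). a k = 0"
    and b0: "\<beta> i j \<noteq> 0 \<Longrightarrow> 1 \<le> j \<and> N0 j \<le> i \<and> i < N0 (Suc p)" for i j
    using Suc.prems(2) unfolding level_coeffs_def by auto
  have b0': "\<beta> i j = 0" if "\<not> (1 \<le> j \<and> j \<le> p)" for i j
  proof (rule ccontr)
    assume "\<beta> i j \<noteq> 0"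
    then have "1 \<le> j" "N0 j < N0 (Suc p)" using b0[of i j] by auto
    then show False using that monoD[OF mono_N0, of "Suc p" j] by (auto simp: not_le)
  qed
  have K: "Kmap \<beta> i = (\<Sum>j=1..p. f j * \<beta> i j)" for i
    unfolding Kmap_def using Suc.prems(1) b0' by (intro sum.mono_neutral_right) auto
  have "\<exists>s. a k = (\<Sum>j=1..p. f j * s j)" if k: "N1 p \<le> k" "k < N1 (Suc p)" for k
  proof -
    have "Dmap a i \<in> ?I" for i
    proof -
      have "Dmap a i = - Kmap \<beta> i" using Suc.prems(3)[of i] by (simp add: eq_neg_iff_add_eq_0)
      moreover have "Kmap \<beta> i \<in> ?I" unfolding K by (auto simp: seq_ideal_iff)
      ultimately show ?thesis using Ic(5) by metis
    qed
    then have "f (Suc p) * a k \<in> ?I"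
      using h_D[of "Suc p" a k] a0 k Suc.prems(1) by (simp add: Dmap_def)
    then have "a k \<in> ?I"
      using regular Suc.prems(1) unfolding weakly_regular_def by (auto dest!: bspec[of _ _ "Suc p"])
    then show ?thesis by (auto simp: seq_ideal_iff)
  qed
  then have "\<forall>k. \<exists>s. N1 p \<le> k \<and> k < N1 (Suc p) \<longrightarrow> a k = (\<Sum>j=1..p. f j * s j)" by blast
  from choice[OF this] obtain s
    where s: "\<And>k. N1 p \<le> k \<Longrightarrow> k < N1 (Suc p) \<Longrightarrow> a k = (\<Sum>j=1..p. f j * s k j)" by blast
  define u where "u j k = (if N1 p \<le> k \<and> k < N1 (Suc p) then s k j else 0)" for j k
  define a' where "a' k = (if k < N1 p then a k else 0)" for k
  \<comment> \<open>the top part of \<open>a\<close>, written with \<open>f\<^sub>1, \<dots>, f\<^sub>p\<close>, and its lower part\<close>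
  have a_eq: "a k = a' k + (\<Sum>j=1..p. f j * u j k)" for k
    using s[of k] a0 by (cases "k < N1 p"; cases "k < N1 (Suc p)") (simp_all add: u_def a'_def)
  have "Dmap a i = Dmap (\<lambda>k. a' k + (\<Sum>j=1..p. f j * u j k)) i" for i
    by (rule arg_cong[of a _ "\<lambda>b. Dmap b i"]) (rule ext, rule a_eq)
  then have Da: "Dmap a i = Dmap a' i + (\<Sum>j=1..p. f j * Dmap (u j) i)" for i
    by (simp only: Dmap_add Dmap_sum Dmap_smult)
  have Da'0: "Dmap a' i = 0" if "N0 p \<le> i" for i
    using that Suc.prems(1) by (intro Dmap_below[of p]) (auto simp: a'_def)
  \<comment> \<open>on the rows of the top block the relation is a syzygy of \<open>f\<^sub>1, \<dots>, f\<^sub>p\<close>\<close>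
  have b_high: "\<beta> i j \<in> J" if i: "N0 p \<le> i" and j: "j \<in> {1..p}" for i j
  proof -
    have "(\<Sum>j=1..p. f j * (Dmap (u j) i + \<beta> i j)) = 0"
      using Suc.prems(3)[of i] Da'0[OF i] by (simp add: Da K distrib_left sum.distrib)
    from regular_syzygy_coefficients[OF regular _ this j] Suc.prems(1) IJ
    have "Dmap (u j) i + \<beta> i j \<in> J" by auto
    from Jc(6)[OF this DmapJ[of "u j" i]] show ?thesis by simp
  qed
  define w where "w j i = (if i < N0 p then Dmap (u j) i else 0)" for j i
  define \<beta>' where "\<beta>' i j = (if i < N0 p then \<beta> i j else 0)" for i j
  \<comment> \<open>below the top block, \<open>f\<^sub>j d(u\<^sub>j)\<close> is rewritten in terms of the columns of level \<open>p\<close>\<close>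
  have "presented p J (\<lambda>i. \<Sum>j=1..p. f j * w j i)"
    by (intro presented_sum[OF J] presented_generator[OF J])
       (use Suc.prems(1) DmapJ Jc(1) in \<open>auto simp: w_def\<close>)
  then obtain \<alpha> \<gamma> where ag: "level_coeffs p J \<alpha> \<gamma>"
    and w_eq: "\<And>i. (\<Sum>j=1..p. f j * w j i) = Dmap \<alpha> i + Kmap \<gamma> i"
    unfolding presented_def by blast
  have lower: "level_coeffs p UNIV a' \<beta>'"
    unfolding level_coeffs_def using b0 by (auto simp: a'_def \<beta>'_def)
  have "level_coeffs p J (\<lambda>k. a' k + \<alpha> k) (\<lambda>i j. \<beta>' i j + \<gamma> i j)"
  proof (rule Suc.IH)
    show "p \<le> c" using Suc.prems(1) by simp
    show "level_coeffs p UNIV (\<lambda>k. a' k + \<alpha> k) (\<lambda>i j. \<beta>' i j + \<gamma> i j)"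
      by (rule level_coeffs_add[OF UNIV_ideal lower]) (use ag in \<open>simp add: level_coeffs_def\<close>)
    fix i
    have "Dmap a' i + Kmap \<beta>' i + (\<Sum>j=1..p. f j * w j i) = 0"
    proof (cases "i < N0 p")
      case True
      then have "Kmap \<beta>' i = Kmap \<beta> i" by (simp add: Kmap_def \<beta>'_def)
      then show ?thesis using Suc.prems(3)[of i] True by (simp add: Da w_def add_ac)
    next
      case False
      then show ?thesis using Da'0 by (simp add: Kmap_def \<beta>'_def w_def)
    qed
    then show "Dmap (\<lambda>k. a' k + \<alpha> k) i + Kmap (\<lambda>i j. \<beta>' i j + \<gamma> i j) i = 0"
      unfolding w_eq Dmap_add Kmap_add by (simp only: add_ac)
  qed
  then have "a' k + \<alpha> k \<in> J" "\<beta>' i j + \<gamma> i j \<in> J" for k i j unfolding level_coeffs_def by auto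
  moreover have "\<alpha> k \<in> J" "\<gamma> i j \<in> J" for k i j using ag unfolding level_coeffs_def by auto
  ultimately have a'J: "a' k \<in> J" and b'J: "\<beta>' i j \<in> J" for k i j
    using Jc(6) by (metis add_diff_cancel_right')+
  have "a k \<in> J" for k
    unfolding a_eq by (intro Jc(2) a'J Jc(7) Jc(4) fJ) (use Suc.prems(1) in auto)
  moreover have "\<beta> i j \<in> J" for i j
    using b_high[of i j] b'J[of i j] b0'[of j i] Jc(1)
    by (cases "i < N0 p"; cases "1 \<le> j \<and> j \<le> p") (auto simp: \<beta>'_def)
  ultimately show ?case using Suc.prems(2) unfolding level_coeffs_def by auto
qed

text \<open>The columns of \<open>d\<close> and of the Koszul blocks together generate all multiples of \<open>f\<^sub>1, \<dots>, f\<^sub>c\<close>, so that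
  working modulo these elements amounts to adding the Koszul columns to those of \<open>d\<close>.\<close>

lemma image_mod_ideal:
  assumes D0: "\<And>i k. N0 c \<le> i \<Longrightarrow> D i k = 0"
  shows "(\<exists>a. \<forall>i<N0 c. v $ i - (\<Sum>k<N1 c. D i k * a k) \<in> seq_ideal f c) \<longleftrightarrow>
    (\<exists>a \<beta>. level_coeffs c UNIV a \<beta> \<and> (\<forall>i<N0 c. v $ i = Dmap a i + Kmap \<beta> i))"
proof
  assume "\<exists>a. \<forall>i<N0 c. v $ i - (\<Sum>k<N1 c. D i k * a k) \<in> seq_ideal f c"
  then obtain a where a: "\<forall>i<N0 c. v $ i - Dmap a i \<in> seq_ideal f c" unfolding Dmap_def by blast
  then have "\<exists>t. i < N0 c \<longrightarrow> v $ i - Dmap a i = (\<Sum>j=1..c. f j * t j)" for i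
    using seq_ideal_iff[of "v $ i - Dmap a i" f c] by blast
  then have "\<forall>i. \<exists>t. i < N0 c \<longrightarrow> v $ i - Dmap a i = (\<Sum>j=1..c. f j * t j)" by blast
  from choice[OF this] obtain t
    where t: "\<And>i. i < N0 c \<Longrightarrow> v $ i - Dmap a i = (\<Sum>j=1..c. f j * t i j)" by blast
  define t' where "t' j i = (if i < N0 c then t i j else 0)" for i j
  define a' where "a' k = (if k < N1 c then a k else 0)" for k
  have "presented c UNIV (\<lambda>i. \<Sum>j=1..c. f j * t' j i)"
    by (intro presented_sum[OF UNIV_ideal] presented_generator_UNIV) (auto simp: t'_def)
  moreover have "presented c UNIV (Dmap a')"
    unfolding presented_def level_coeffs_def
    by (intro exI[of _ a'] exI[of _ "\<lambda>_ _. 0"]) (auto simp: a'_def Kmap_def)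
  ultimately have "presented c UNIV (\<lambda>i. Dmap a' i + (\<Sum>j=1..c. f j * t' j i))"
    by (rule presented_add[OF UNIV_ideal, rotated])
  then obtain b \<beta> where b: "level_coeffs c UNIV b \<beta>"
    and eq: "\<And>i. Dmap a' i + (\<Sum>j=1..c. f j * t' j i) = Dmap b i + Kmap \<beta> i"
    unfolding presented_def by blast
  have "v $ i = Dmap b i + Kmap \<beta> i" if i: "i < N0 c" for i
  proof -
    have "Dmap a' i = Dmap a i" by (simp add: Dmap_def a'_def)
    moreover have "(\<Sum>j=1..c. f j * t' j i) = v $ i - Dmap a i" using t[OF i] i by (simp add: t'_def)
    ultimately show ?thesis using eq[of i] by (metis add.commute diff_add_cancel)
  qed
  then show "\<exists>a \<beta>. level_coeffs c UNIV a \<beta> \<and> (\<forall>i<N0 c. v $ i = Dmap a i + Kmap \<beta> i)" using b by blast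
next
  assume "\<exists>a \<beta>. level_coeffs c UNIV a \<beta> \<and> (\<forall>i<N0 c. v $ i = Dmap a i + Kmap \<beta> i)"
  then obtain a \<beta> where "\<forall>i<N0 c. v $ i = Dmap a i + Kmap \<beta> i" by blast
  then have "\<forall>i<N0 c. v $ i - Dmap a i \<in> seq_ideal f c" by (auto simp: Kmap_def seq_ideal_iff)
  then show "\<exists>a. \<forall>i<N0 c. v $ i - (\<Sum>k<N1 c. D i k * a k) \<in> seq_ideal f c" unfolding Dmap_def by blast
qed

end

section \<open>Linear combinations, bases and submodules IM\<close>

text \<open>Unlike the library's finite sums, this recursion does not depend on the carrier of \<open>M\<close>, so that linear
  combinations in a submodule are literally those of the ambient module.\<close>

primrec lcomb :: "('a::comm_ring_1, 'b) module \<Rightarrow> nat \<Rightarrow> (nat \<Rightarrow> 'a) \<Rightarrow> (nat \<Rightarrow> 'b) \<Rightarrow> 'b" where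
  "lcomb M 0 a x = \<zero>\<^bsub>M\<^esub>"
| "lcomb M (Suc n) a x = lcomb M n a x \<oplus>\<^bsub>M\<^esub> (a n \<odot>\<^bsub>M\<^esub> x n)"

lemma lcomb_submod [simp]: "lcomb (submod M N) n a x = lcomb M n a x"
  by (induction n) auto

lemma lcomb_cong:
  assumes "\<And>i. i < n \<Longrightarrow> a i = b i" and "\<And>i. i < n \<Longrightarrow> x i = y i"
  shows "lcomb M n a x = lcomb M n b y"
  using assms by (induction n) auto

text \<open>The rewrite rules of the sublocale make scalars plain ring elements, without carrier conditions.\<close>

locale Smod = fixes M :: "('a::comm_ring_1, 'b) module" (structure) assumes Smod: "Smodule M"
begin

sublocale MM: Module.module "class_ring :: 'a ring" M
  rewrites "carrier (class_ring :: 'a ring) = UNIV"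
    and "monoid.mult (class_ring :: 'a ring) = (*)"
    and "add (class_ring :: 'a ring) = (+)"
    and "one (class_ring :: 'a ring) = 1"
    and "zero (class_ring :: 'a ring) = 0"
    and "a_inv (class_ring :: 'a ring) = uminus"
  using Smod by (auto simp: class_ring_simps)

lemma lcomb_closed [simp, intro]:
  "(\<And>i. i < n \<Longrightarrow> x i \<in> carrier M) \<Longrightarrow> lcomb M n a x \<in> carrier M"
  by (induction n) auto

lemma lcomb_zero:
  "(\<And>i. i < n \<Longrightarrow> x i \<in> carrier M) \<Longrightarrow> (\<And>i. i < n \<Longrightarrow> a i = 0) \<Longrightarrow> lcomb M n a x = \<zero>"
  by (induction n) auto

lemma lcomb_add:
  "(\<And>i. i < n \<Longrightarrow> x i \<in> carrier M) \<Longrightarrow>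
   lcomb M n (\<lambda>i. a i + b i) x = lcomb M n a x \<oplus> lcomb M n b x"
  by (induction n) (auto simp: MM.smult_l_distr MM.M.a_ac)

lemma lcomb_smult:
  "(\<And>i. i < n \<Longrightarrow> x i \<in> carrier M) \<Longrightarrow> lcomb M n (\<lambda>i. s * a i) x = s \<odot> lcomb M n a x"
  by (induction n) (auto simp: MM.smult_r_distr MM.smult_assoc1)

lemma lcomb_minus:
  assumes "\<And>i. i < n \<Longrightarrow> x i \<in> carrier M"
  shows "lcomb M n (\<lambda>i. a i - b i) x = lcomb M n a x \<ominus> lcomb M n b x"
proof -
  have "lcomb M n (\<lambda>i. a i - b i) x \<oplus> lcomb M n b x = lcomb M n a x"
    using lcomb_add[OF assms, where a = "\<lambda>i. a i - b i" and b = b] by simp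
  then show ?thesis using assms
    by (metis MM.M.add.inv_solve_right MM.M.minus_eq lcomb_closed)
qed

lemma lcomb_delta:
  "(\<And>i. i < n \<Longrightarrow> x i \<in> carrier M) \<Longrightarrow> j < n \<Longrightarrow> lcomb M n (\<lambda>i. if i = j then s else 0) x = s \<odot> x j"
proof (induction n)
  case (Suc n)
  show ?case
  proof (cases "j = n")
    case True
    then show ?thesis using Suc.prems by (simp add: lcomb_zero)
  next
    case False
    then show ?thesis using Suc by simp
  qed
qed simp

lemma lcomb_add_length:
  "(\<And>i. i < m + n \<Longrightarrow> x i \<in> carrier M) \<Longrightarrow>
   lcomb M (m + n) a x = lcomb M m a x \<oplus> lcomb M n (\<lambda>i. a (m + i)) (\<lambda>i. x (m + i))"
  by (induction n) (auto simp: MM.M.a_assoc)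

lemma lcomb_truncate:
  assumes "\<And>i. i < m \<Longrightarrow> x i \<in> carrier M" and "n \<le> m" and "\<And>i. n \<le> i \<Longrightarrow> i < m \<Longrightarrow> a i = 0"
  shows "lcomb M m a x = lcomb M n a x"
proof -
  have "lcomb M (m - n) (\<lambda>i. a (n + i)) (\<lambda>i. x (n + i)) = \<zero>"
    by (rule lcomb_zero) (use assms in auto)
  then show ?thesis using lcomb_add_length[of n "m - n" x a] assms by simp
qed

lemma lcomb_lcomb:
  assumes "\<And>j. j < m \<Longrightarrow> y j \<in> carrier M"
  shows "lcomb M n a (\<lambda>i. lcomb M m (b i) y) = lcomb M m (\<lambda>j. \<Sum>i<n. b i j * a i) y"
  using assms
  by (induction n) (auto simp: lcomb_zero lcomb_add lcomb_smult[symmetric] mult.commute)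

lemma lcomb_submodule:
  assumes "Ssubmodule N M" and "\<And>i. i < n \<Longrightarrow> x i \<in> N"
  shows "lcomb M n a x \<in> N"
proof -
  interpret N: submodule "class_ring :: 'a ring" N M by fact
  show ?thesis using assms(2) by (induction n) auto
qed

lemma finsum_lcomb:
  "(\<And>i. i < n \<Longrightarrow> x i \<in> carrier M) \<Longrightarrow> (\<Oplus>i\<in>{..<n}. a i \<odot> x i) = lcomb M n a x"
proof (induction n)
  case (Suc n)
  then show ?case
    by (simp add: lessThan_Suc MM.M.finsum_insert Pi_def MM.M.a_comm)
qed simp

end

lemma Shom_lcomb:
  assumes "Smodule M" "Smodule N" "g \<in> Shom M N" "\<And>i. i < n \<Longrightarrow> x i \<in> carrier M"
  shows "g (lcomb M n a x) = lcomb N n a (\<lambda>i. g (x i))"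
proof -
  interpret M: Smod M by (rule Smod.intro) fact
  interpret g: mod_hom "class_ring :: 'a ring" M N g
    by (rule mod_hom.intro) (use assms in \<open>auto simp: mod_hom_axioms_def\<close>)
  show ?thesis using assms(4) by (induction n) auto
qed

text \<open>Bases as families, so that coefficients are functions on indices rather than on elements.\<close>

definition is_basis :: "('a::comm_ring_1, 'b) module \<Rightarrow> nat \<Rightarrow> (nat \<Rightarrow> 'b) \<Rightarrow> bool" where
  "is_basis M n x \<longleftrightarrow> (\<forall>i<n. x i \<in> carrier M) \<and> (\<forall>v\<in>carrier M. \<exists>a. v = lcomb M n a x) \<and>
     (\<forall>a. lcomb M n a x = \<zero>\<^bsub>M\<^esub> \<longrightarrow> (\<forall>i<n. a i = 0))"

context Smod begin

lemma basis_unique: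
  assumes "is_basis M n x" and "lcomb M n a x = lcomb M n b x" and "i < n"
  shows "a i = b i"
proof -
  have x: "\<And>i. i < n \<Longrightarrow> x i \<in> carrier M" using assms(1) by (auto simp: is_basis_def)
  have "lcomb M n (\<lambda>i. a i - b i) x = \<zero>"
    by (subst lcomb_minus[OF x]) (use assms(2) x in \<open>auto simp: MM.M.minus_eq MM.M.r_neg\<close>)
  then have "a i - b i = 0" using assms(1,3) by (auto simp: is_basis_def)
  then show ?thesis by simp
qed

lemma lincomb_lcomb:
  assumes "set xs \<subseteq> carrier M" "distinct xs"
  shows "MM.lincomb b (set xs) = lcomb M (length xs) (\<lambda>i. b (xs ! i)) (nth xs)"
proof -
  have "set xs = nth xs ` {..<length xs}" by (auto simp: set_conv_nth)
  moreover have "inj_on (nth xs) {..<length xs}" using assms(2) by (simp add: inj_on_nth)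
  moreover have "(\<lambda>v. b v \<odot> v) \<in> nth xs ` {..<length xs} \<rightarrow> carrier M"
    using assms(1) nth_mem by (fastforce intro!: MM.smult_closed)
  ultimately have "MM.lincomb b (set xs) = (\<Oplus>i\<in>{..<length xs}. b (xs ! i) \<odot> xs ! i)"
    unfolding MM.lincomb_def by (simp add: MM.M.add.finprod_reindex)
  also have "\<dots> = lcomb M (length xs) (\<lambda>i. b (xs ! i)) (nth xs)"
    by (rule finsum_lcomb) (use assms in auto)
  finally show ?thesis .
qed

lemma lcomb_lincomb:
  assumes "set xs \<subseteq> carrier M" "distinct xs"
  obtains b where "MM.lincomb b (set xs) = lcomb M (length xs) a (nth xs)"
    and "\<And>i. i < length xs \<Longrightarrow> b (xs ! i) = a i"
proof -
  let ?b = "\<lambda>v. a (the_inv_into {..<length xs} (nth xs) v)"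
  have b: "?b (xs ! i) = a i" if "i < length xs" for i
    using that assms(2) by (subst the_inv_into_f_f) (auto simp: inj_on_nth)
  have "MM.lincomb ?b (set xs) = lcomb M (length xs) a (nth xs)"
    unfolding lincomb_lcomb[OF assms] by (rule lcomb_cong) (auto simp: b)
  then show thesis using that b by blast
qed

text \<open>A family of elements with the coefficient property is repetition free because \<open>1 \<noteq> 0\<close>: two
  equal members would give the expansion of one element in two ways.\<close>

lemma ordered_basis_iff: "ordered_basis M xs \<longleftrightarrow> is_basis M (length xs) (nth xs)"
proof
  assume ob: "ordered_basis M xs"
  then have xs: "set xs \<subseteq> carrier M" "distinct xs" and li: "\<not> MM.lin_dep (set xs)"
    and sp: "MM.span (set xs) = carrier M" unfolding ordered_basis_def by auto
  show "is_basis M (length xs) (nth xs)" unfolding is_basis_def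
  proof (intro conjI ballI allI impI)
    show "xs ! i \<in> carrier M" if "i < length xs" for i using xs that by auto
    show "\<exists>a. v = lcomb M (length xs) a (nth xs)" if v: "v \<in> carrier M" for v
    proof -
      obtain b where "MM.lincomb b (set xs) = v"
        using MM.finite_in_span[of "set xs" v] xs(1) v sp by auto
      then show ?thesis using lincomb_lcomb[OF xs, of b] by auto
    qed
    fix a i assume a: "lcomb M (length xs) a (nth xs) = \<zero>" and i: "i < length xs"
    obtain b where "MM.lincomb b (set xs) = lcomb M (length xs) a (nth xs)"
      and b: "\<And>i. i < length xs \<Longrightarrow> b (xs ! i) = a i" using lcomb_lincomb[OF xs, of a] by blast
    then show "a i = 0"
      using MM.lin_dep_crit[of "set xs" "set xs" b "xs ! i"] li i a by auto
  qed
next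
  assume bas: "is_basis M (length xs) (nth xs)"
  then have c: "\<And>i. i < length xs \<Longrightarrow> xs ! i \<in> carrier M"
    and sp: "\<And>v. v \<in> carrier M \<Longrightarrow> \<exists>a. v = lcomb M (length xs) a (nth xs)"
    and li: "\<And>a i. lcomb M (length xs) a (nth xs) = \<zero> \<Longrightarrow> i < length xs \<Longrightarrow> a i = 0"
    unfolding is_basis_def by auto
  have sub: "set xs \<subseteq> carrier M" using c by (auto simp: set_conv_nth)
  have dist: "distinct xs"
  proof (rule ccontr)
    assume "\<not> distinct xs"
    then obtain i j where ij: "i < length xs" "j < length xs" "i \<noteq> j" "xs ! i = xs ! j"
      by (auto simp: distinct_conv_nth)
    have "lcomb M (length xs) (\<lambda>k. if k = i then 1 else 0) (nth xs) =
          lcomb M (length xs) (\<lambda>k. if k = j then 1 else 0) (nth xs)"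
      using ij c by (simp add: lcomb_delta)
    from basis_unique[OF bas this ij(1)] ij(3) show False by simp
  qed
  have "\<not> MM.lin_dep (set xs)"
  proof (rule MM.finite_lin_indpt2[OF _ sub])
    fix b assume "MM.lincomb b (set xs) = \<zero>"
    then show "\<forall>v\<in>set xs. b v = 0"
      unfolding lincomb_lcomb[OF sub dist] using li[of "\<lambda>i. b (xs ! i)"] by (auto simp: set_conv_nth)
  qed simp
  moreover have "MM.span (set xs) = carrier M"
  proof
    show "MM.span (set xs) \<subseteq> carrier M" using MM.finite_span[OF _ sub] sub by auto
    show "carrier M \<subseteq> MM.span (set xs)"
    proof
      fix v assume "v \<in> carrier M"
      then obtain a where "v = lcomb M (length xs) a (nth xs)" using sp by blast
      moreover obtain b where "MM.lincomb b (set xs) = lcomb M (length xs) a (nth xs)"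
        using lcomb_lincomb[OF sub dist, of a] by blast
      ultimately have "v = MM.lincomb b (set xs)" by simp
      moreover have "MM.lincomb b (set xs) \<in> MM.span (set xs)"
        unfolding MM.span_def by (intro CollectI exI[of _ b] exI[of _ "set xs"]) auto
      ultimately show "v \<in> MM.span (set xs)" by simp
    qed
  qed
  ultimately show "ordered_basis M xs" unfolding ordered_basis_def using sub dist by simp
qed

lemma ideal_mod_subset:
  fixes J :: "'a set"
  shows "ideal_mod J M \<subseteq> carrier M" and "Ssubmodule (ideal_mod J M) M"
    and "s \<in> J \<Longrightarrow> x \<in> carrier M \<Longrightarrow> s \<odot> x \<in> ideal_mod J M"
proof -
  let ?S = "{a \<odot> x | a x. a \<in> J \<and> x \<in> carrier M}"
  have S: "?S \<subseteq> carrier M" by auto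
  show sub: "Ssubmodule (ideal_mod J M) M"
    unfolding ideal_mod_def by (rule MM.span_is_submodule[OF S])
  then show "ideal_mod J M \<subseteq> carrier M" by (rule submodule.subset)
  show "s \<in> J \<Longrightarrow> x \<in> carrier M \<Longrightarrow> s \<odot> x \<in> ideal_mod J M"
    using MM.in_own_span[OF S] unfolding ideal_mod_def by auto
qed

text \<open>The set \<open>{a x | a \<in> J}\<close> is closed under scalar multiplication since \<open>J\<close> is an ideal, hence its span
  consists of sums only.\<close>

lemma ideal_mod_induct [consumes 2, case_names zero add smult]:
  assumes J: "ideal J (class_ring :: 'a ring)" and v: "v \<in> ideal_mod J M"
    and zero: "P \<zero>"
    and add: "\<And>u v. u \<in> carrier M \<Longrightarrow> v \<in> carrier M \<Longrightarrow> P u \<Longrightarrow> P v \<Longrightarrow> P (u \<oplus> v)"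
    and smult: "\<And>s x. s \<in> J \<Longrightarrow> x \<in> carrier M \<Longrightarrow> P (s \<odot> x)"
  shows "P v"
proof -
  let ?S = "{a \<odot> x | a x. a \<in> J \<and> x \<in> carrier M}"
  obtain b A where A: "finite A" "A \<subseteq> ?S" and v: "v = MM.lincomb b A"
    using v unfolding ideal_mod_def MM.span_def by auto
  have "P (\<Oplus>u\<in>A. b u \<odot> u)"
    using A
  proof (induction A rule: finite_induct)
    case empty
    then show ?case using zero by simp
  next
    case (insert u A)
    have carr: "(\<lambda>u. b u \<odot> u) \<in> A \<rightarrow> carrier M" using insert.prems by auto
    obtain a x where ax: "u = a \<odot> x" "a \<in> J" "x \<in> carrier M" using insert.prems by auto
    then have "b u \<odot> u = (b u * a) \<odot> x" by (simp add: MM.smult_assoc1)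
    moreover have "b u * a \<in> J" using class_ideal_closed(3)[OF J ax(2)] .
    ultimately have "P (b u \<odot> u)" using smult ax(3) by metis
    moreover have "(\<Oplus>u\<in>insert u A. b u \<odot> u) = (b u \<odot> u) \<oplus> (\<Oplus>u\<in>A. b u \<odot> u)"
      using insert.hyps carr ax by (intro MM.M.finsum_insert) auto
    ultimately show ?case
      using insert.IH insert.prems carr ax by (auto intro!: add MM.M.finsum_closed)
  qed
  then show ?thesis unfolding v MM.lincomb_def .
qed

lemma lcomb_ideal_mod:
  assumes "\<And>i. i < n \<Longrightarrow> x i \<in> carrier M" "\<And>i. i < n \<Longrightarrow> a i \<in> J"
  shows "lcomb M n a x \<in> ideal_mod J M"
proof -
  interpret N: submodule "class_ring :: 'a ring" "ideal_mod J M" M by (rule ideal_mod_subset)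
  show ?thesis using assms by (induction n) (auto intro: ideal_mod_subset(3))
qed

lemma ideal_mod_coordinates:
  assumes J: "ideal J (class_ring :: 'a ring)" and v: "v \<in> ideal_mod J M" and bas: "is_basis M n x"
  shows "\<exists>a. v = lcomb M n a x \<and> (\<forall>i. a i \<in> J)"
proof -
  have x: "\<And>i. i < n \<Longrightarrow> x i \<in> carrier M" using bas by (auto simp: is_basis_def)
  note Jc = class_ideal_closed[OF J]
  show ?thesis
    using J v
  proof (induction rule: ideal_mod_induct)
    case zero
    show ?case using x Jc(1) by (intro exI[of _ "\<lambda>_. 0"]) (simp add: lcomb_zero)
  next
    case (add u v)
    then obtain a b where "u = lcomb M n a x" "v = lcomb M n b x" "\<forall>i. a i \<in> J" "\<forall>i. b i \<in> J" by blast
    then show ?case using x Jc(2) by (intro exI[of _ "\<lambda>i. a i + b i"]) (simp add: lcomb_add)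
  next
    case (smult s v)
    then obtain a where "v = lcomb M n a x" using bas by (auto simp: is_basis_def)
    then show ?case using x Jc(4)[OF smult(1)] by (intro exI[of _ "\<lambda>i. s * a i"]) (simp add: lcomb_smult)
  qed
qed

lemma lcomb_in_ideal_mod_iff:
  assumes J: "ideal J (class_ring :: 'a ring)" and bas: "is_basis M n x"
  shows "lcomb M n a x \<in> ideal_mod J M \<longleftrightarrow> (\<forall>i<n. a i \<in> J)"
proof
  assume "lcomb M n a x \<in> ideal_mod J M"
  from ideal_mod_coordinates[OF J this bas] obtain b
    where "lcomb M n a x = lcomb M n b x" "\<And>i. b i \<in> J" by blast
  then show "\<forall>i<n. a i \<in> J" using basis_unique[OF bas] by metis
next
  assume "\<forall>i<n. a i \<in> J"
  then show "lcomb M n a x \<in> ideal_mod J M" using bas by (intro lcomb_ideal_mod) (auto simp: is_basis_def)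
qed

end

lemma ideal_mod_submod:
  assumes M: "Smodule M" and N: "Ssubmodule N M" and J: "ideal J (class_ring :: 'a::comm_ring_1 ring)"
  shows "ideal_mod J (submod M N) \<subseteq> ideal_mod J (M :: ('a, 'b) module)"
proof
  fix v assume v: "v \<in> ideal_mod J (submod M N)"
  interpret M: Smod M by (rule Smod.intro) fact
  interpret N: Smod "submod M N" by (rule Smod.intro, rule M.MM.submodule_is_module[OF N])
  interpret I: submodule "class_ring :: 'a ring" "ideal_mod J M" M by (rule M.ideal_mod_subset)
  have NM: "N \<subseteq> carrier M" using N by (rule submodule.subset)
  show "v \<in> ideal_mod J M"
    using J v
  proof (induction rule: N.ideal_mod_induct)
    case zero
    show ?case using I.zero_closed by simp
  next
    case (add u v)
    then show ?case using I.m_closed by simp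
  next
    case (smult s x)
    then show ?case using M.ideal_mod_subset(3) NM by auto
  qed
qed

lemma module_vec_Smod: "Smod (module_vec TYPE('a::comm_ring_1) n)"
proof -
  interpret V: vec_module "TYPE('a)" n .
  show ?thesis by (rule Smod.intro) (rule V.module_axioms)
qed

text \<open>The standard basis turns membership in \<open>J S\<^sup>n\<close>, as in the definition of minimality, into a condition on
  the entries of vectors.\<close>

lemma unit_vec_basis: "is_basis (module_vec TYPE('a::comm_ring_1) n) n (unit_vec n)"
  and lcomb_unit_vec: "v \<in> carrier_vec n \<Longrightarrow>
    lcomb (module_vec TYPE('a) n) n (vec_index v) (unit_vec n) = (v :: 'a vec)"
proof -
  let ?V = "module_vec TYPE('a) n"
  have carr: "lcomb ?V r a (unit_vec n) \<in> carrier_vec n" for r a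
    by (induction r) (auto simp: module_vec_simps)
  have index: "lcomb ?V r a (unit_vec n) $ i = (if i < r then a i else 0)" if "i < n" "r \<le> n" for r a i
    using that(2)
  proof (induction r)
    case 0
    then show ?case using that by (simp add: module_vec_simps)
  next
    case (Suc r)
    have "lcomb ?V (Suc r) a (unit_vec n) $ i = lcomb ?V r a (unit_vec n) $ i + a r * unit_vec n r $ i"
      using that carr[of r a] by (simp add: module_vec_simps)
    then show ?case using Suc that by (auto simp: less_Suc_eq)
  qed
  show eq: "lcomb ?V n (vec_index v) (unit_vec n) = v" if "v \<in> carrier_vec n" for v
    using that carr[of n "vec_index v"] index by (intro eq_vecI) auto
  show "is_basis ?V n (unit_vec n)"
    unfolding is_basis_def
  proof (intro conjI ballI allI impI)
    show "unit_vec n i \<in> carrier ?V" for i by (simp add: module_vec_simps)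
    show "\<exists>a. v = lcomb ?V n a (unit_vec n)" if "v \<in> carrier ?V" for v
      using eq[of v] that by (metis module_vec_simps(3))
    fix a i assume "lcomb ?V n a (unit_vec n) = \<zero>\<^bsub>?V\<^esub>" "i < n"
    then show "a i = 0" using index[of i n a] by (simp add: module_vec_simps)
  qed
qed

lemma vec_in_ideal_mod_iff:
  fixes J :: "'a::comm_ring_1 set"
  assumes "ideal J (class_ring :: 'a ring)" and v: "v \<in> carrier_vec n"
  shows "v \<in> ideal_mod J (module_vec TYPE('a) n) \<longleftrightarrow> (\<forall>i<n. v $ i \<in> J)"
  using Smod.lcomb_in_ideal_mod_iff[OF module_vec_Smod assms(1) unit_vec_basis, of n "vec_index v"]
  unfolding lcomb_unit_vec[OF v] .

section \<open>Quotient modules and adapted bases\<close>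

lemma coset_submod [simp]: "a_r_coset (submod M F) = a_r_coset M"
  by (simp add: a_r_coset_def r_coset_def fun_eq_iff)

context Smod begin

lemma submodule_subgroup:
  assumes "Ssubmodule N M" shows "abelian_subgroup N M"
proof (rule abelian_subgroupI3)
  interpret N: submodule "class_ring :: 'a ring" N M by fact
  have neg: "\<ominus> x \<in> N" if "x \<in> N" for x
  proof -
    have "\<ominus> x = -1 \<odot> x" using MM.smult_minus_1[of x] that N.subset by auto
    then show ?thesis using N.smult_closed[of "-1" x] that by simp
  qed
  then have "subgroup N (add_monoid M)"
    by (intro subgroup.intro) (use N.subset in \<open>auto simp flip: a_inv_def\<close>)
  then show "additive_subgroup N M" by (rule additive_subgroupI)
  show "abelian_group M" by (rule MM.M.abelian_group_axioms)
qed

lemma coset_eq_iff: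
  assumes N: "Ssubmodule N M" and "x \<in> carrier M" "y \<in> carrier M"
  shows "N +> x = N +> y \<longleftrightarrow> x \<ominus> y \<in> N"
proof -
  interpret N: abelian_subgroup N M by (rule submodule_subgroup[OF N])
  have "x \<ominus> y \<in> N \<longleftrightarrow> x \<in> N +> y"
    using assms by (simp add: N.a_rcos_module MM.M.minus_eq)
  also have "\<dots> \<longleftrightarrow> N +> x = N +> y"
    using N.a_repr_independence'[of x y] N.a_rcos_self[of x] assms by auto
  finally show ?thesis by simp
qed

lemma coset_zero_iff:
  assumes N: "Ssubmodule N M" and "x \<in> carrier M"
  shows "N +> x = N \<longleftrightarrow> x \<in> N"
proof -
  interpret N: abelian_subgroup N M by (rule submodule_subgroup[OF N])
  show ?thesis using N.a_rcos_self[of x] N.a_rcos_const[of x] assms by auto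
qed

lemma quot_carrier: "carrier (quot_module M N) = (\<lambda>x. N +> x) ` carrier M"
  by (auto simp: quot_module_def A_RCOSETS_def')

lemma quot_zero: "\<zero>\<^bsub>quot_module M N\<^esub> = N"
  by (simp add: quot_module_def)

lemma quot_add:
  assumes N: "Ssubmodule N M" and "x \<in> carrier M" "y \<in> carrier M"
  shows "(N +> x) \<oplus>\<^bsub>quot_module M N\<^esub> (N +> y) = N +> (x \<oplus> y)"
proof -
  interpret N: abelian_subgroup N M by (rule submodule_subgroup[OF N])
  show ?thesis using assms by (simp add: quot_module_def N.a_rcos_sum)
qed

text \<open>Maps on cosets are defined as unions over representatives; these collapse if all representatives
  give the same value.\<close>

lemma coset_union_const:
  assumes N: "Ssubmodule N M" and x: "x \<in> carrier M" and "\<And>y. y \<in> N +> x \<Longrightarrow> g y = g x"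
  shows "(\<Union>y\<in>N +> x. g y) = g x"
proof -
  interpret N: abelian_subgroup N M by (rule submodule_subgroup[OF N])
  show ?thesis using assms(3) N.a_rcos_self[OF x] by blast
qed

lemma quot_smult:
  assumes N: "Ssubmodule N M" and x: "x \<in> carrier M"
  shows "s \<odot>\<^bsub>quot_module M N\<^esub> (N +> x) = N +> (s \<odot> x)"
proof -
  interpret N: abelian_subgroup N M by (rule submodule_subgroup[OF N])
  interpret N': submodule "class_ring :: 'a ring" N M by fact
  have "N +> (s \<odot> y) = N +> (s \<odot> x)" if "y \<in> N +> x" for y
  proof -
    have y: "y \<in> carrier M" using that N.a_elemrcos_carrier[OF x] by auto
    have "y \<ominus> x \<in> N" using that x y by (simp add: N.a_rcos_module MM.M.minus_eq)
    then have "s \<odot> (y \<ominus> x) \<in> N" by auto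
    moreover have "s \<odot> (y \<ominus> x) = s \<odot> y \<ominus> s \<odot> x"
      using x y by (simp add: MM.M.minus_eq MM.smult_r_distr MM.smult_r_minus)
    ultimately show ?thesis using x y by (simp add: coset_eq_iff[OF N])
  qed
  then show ?thesis using coset_union_const[OF N x, of "\<lambda>y. N +> (s \<odot> y)"] by (simp add: quot_module_def)
qed

lemma quot_Smodule:
  assumes N: "Ssubmodule N M" shows "Smodule (quot_module M N)"
proof (rule module_criteria)
  let ?Q = "quot_module M N"
  have zero: "\<zero>\<^bsub>?Q\<^esub> = N +> \<zero>"
    using coset_zero_iff[OF N MM.M.zero_closed] submodule.zero_closed[OF N] by (simp add: quot_zero)
  note Qs = quot_carrier zero quot_add[OF N] quot_smult[OF N]
  show "cring (class_ring :: 'a ring)" by (rule class_cring.cring_axioms)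
  show "\<zero>\<^bsub>?Q\<^esub> \<in> carrier ?Q" by (auto simp: Qs)
  show "\<forall>v w. v \<in> carrier ?Q \<and> w \<in> carrier ?Q \<longrightarrow> v \<oplus>\<^bsub>?Q\<^esub> w \<in> carrier ?Q" by (auto simp: Qs)
  show "\<forall>v\<in>carrier ?Q. \<exists>w\<in>carrier ?Q. v \<oplus>\<^bsub>?Q\<^esub> w = \<zero>\<^bsub>?Q\<^esub>"
  proof
    fix v assume "v \<in> carrier ?Q"
    then obtain x where "x \<in> carrier M" "v = N +> x" by (auto simp: quot_carrier)
    then show "\<exists>w\<in>carrier ?Q. v \<oplus>\<^bsub>?Q\<^esub> w = \<zero>\<^bsub>?Q\<^esub>"
      by (intro bexI[of _ "N +> (\<ominus> x)"]) (auto simp: Qs MM.M.r_neg)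
  qed
  show "\<forall>s v. s \<in> carrier (class_ring :: 'a ring) \<and> v \<in> carrier ?Q \<longrightarrow> s \<odot>\<^bsub>?Q\<^esub> v \<in> carrier ?Q"
    by (auto simp: Qs)
  show "\<forall>v w. v \<in> carrier ?Q \<and> w \<in> carrier ?Q \<longrightarrow> v \<oplus>\<^bsub>?Q\<^esub> w = w \<oplus>\<^bsub>?Q\<^esub> v"
    by (auto simp: Qs MM.M.a_comm)
  show "\<forall>v w x. v \<in> carrier ?Q \<and> w \<in> carrier ?Q \<and> x \<in> carrier ?Q \<longrightarrow>
      v \<oplus>\<^bsub>?Q\<^esub> w \<oplus>\<^bsub>?Q\<^esub> x = v \<oplus>\<^bsub>?Q\<^esub> (w \<oplus>\<^bsub>?Q\<^esub> x)"
    by (auto simp: Qs MM.M.a_assoc)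
  show "\<forall>v\<in>carrier ?Q. v \<oplus>\<^bsub>?Q\<^esub> \<zero>\<^bsub>?Q\<^esub> = v" by (auto simp: Qs)
  show "\<forall>s t v. s \<in> carrier (class_ring :: 'a ring) \<and> t \<in> carrier (class_ring :: 'a ring) \<and> v \<in> carrier ?Q \<longrightarrow>
      (s \<otimes>\<^bsub>class_ring\<^esub> t) \<odot>\<^bsub>?Q\<^esub> v = s \<odot>\<^bsub>?Q\<^esub> (t \<odot>\<^bsub>?Q\<^esub> v)"
    by (auto simp: Qs MM.smult_assoc1)
  show "\<forall>v\<in>carrier ?Q. \<one>\<^bsub>class_ring\<^esub> \<odot>\<^bsub>?Q\<^esub> v = v" by (auto simp: Qs)
  show "\<forall>s t v. s \<in> carrier (class_ring :: 'a ring) \<and> t \<in> carrier (class_ring :: 'a ring) \<and> v \<in> carrier ?Q \<longrightarrow>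
      (s \<oplus>\<^bsub>class_ring\<^esub> t) \<odot>\<^bsub>?Q\<^esub> v = s \<odot>\<^bsub>?Q\<^esub> v \<oplus>\<^bsub>?Q\<^esub> t \<odot>\<^bsub>?Q\<^esub> v"
    by (auto simp: Qs MM.smult_l_distr)
  show "\<forall>s v w. s \<in> carrier (class_ring :: 'a ring) \<and> v \<in> carrier ?Q \<and> w \<in> carrier ?Q \<longrightarrow>
      s \<odot>\<^bsub>?Q\<^esub> (v \<oplus>\<^bsub>?Q\<^esub> w) = s \<odot>\<^bsub>?Q\<^esub> v \<oplus>\<^bsub>?Q\<^esub> s \<odot>\<^bsub>?Q\<^esub> w"
    by (auto simp: Qs MM.smult_r_distr)
qed

lemma quot_hom:
  assumes N: "Ssubmodule N M" shows "(\<lambda>x. N +> x) \<in> Shom M (quot_module M N)"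
  unfolding LinearCombinations.module_hom_def using quot_add[OF N] quot_smult[OF N] by (auto simp: quot_carrier)

lemma quot_lcomb:
  assumes N: "Ssubmodule N M" and "\<And>i. i < n \<Longrightarrow> x i \<in> carrier M"
  shows "N +> lcomb M n a x = lcomb (quot_module M N) n a (\<lambda>i. N +> x i)"
  by (rule Shom_lcomb[OF Smod quot_Smodule[OF N] quot_hom[OF N]]) (use assms in auto)

text \<open>Subtracting the lift of an expansion in \<open>M/N\<close> leaves an element of \<open>N\<close>, which has an expansion there.
  A relation is first read in \<open>M/N\<close>, where it shows that the coefficients of the lifts vanish.\<close>

lemma lift_basis:
  assumes N: "Ssubmodule N M" and y: "is_basis (submod M N) m y"
    and X: "is_basis (quot_module M N) n (\<lambda>i. N +> x i)" and x: "\<And>i. i < n \<Longrightarrow> x i \<in> carrier M"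
  shows "is_basis M (m + n) (\<lambda>i. if i < m then y i else x (i - m))"
proof -
  let ?z = "\<lambda>i. if i < m then y i else x (i - m)"
  interpret N: submodule "class_ring :: 'a ring" N M by fact
  interpret Q: Smod "quot_module M N" by (rule Smod.intro) (rule quot_Smodule[OF N])
  have yN: "\<And>i. i < m \<Longrightarrow> y i \<in> N" using y by (auto simp: is_basis_def)
  then have yM: "\<And>i. i < m \<Longrightarrow> y i \<in> carrier M" using N.subset by auto
  have zM: "\<And>i. i < m + n \<Longrightarrow> ?z i \<in> carrier M" using yM x by auto
  have z_split: "lcomb M (m + n) a ?z = lcomb M m a y \<oplus> lcomb M n (\<lambda>i. a (m + i)) x" for a
  proof -
    have "lcomb M m a ?z = lcomb M m a y" by (rule lcomb_cong) auto
    moreover have "lcomb M n (\<lambda>i. a (m + i)) (\<lambda>i. ?z (m + i)) = lcomb M n (\<lambda>i. a (m + i)) x"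
      by (rule lcomb_cong) auto
    ultimately show ?thesis using lcomb_add_length[of m n ?z a] zM by metis
  qed
  have yl: "lcomb M m a y \<in> N" for a by (rule lcomb_submodule[OF N yN])
  have xl: "lcomb M n a x \<in> carrier M" for a by (rule lcomb_closed) (rule x)
  have ql: "N +> lcomb M n a x = lcomb (quot_module M N) n a (\<lambda>i. N +> x i)" for a
    by (rule quot_lcomb[OF N]) (rule x)
  show ?thesis
    unfolding is_basis_def
  proof (intro conjI ballI allI impI)
    show "?z i \<in> carrier M" if "i < m + n" for i using zM that by blast
    show "\<exists>a. v = lcomb M (m + n) a ?z" if v: "v \<in> carrier M" for v
    proof -
      obtain b where "N +> v = lcomb (quot_module M N) n b (\<lambda>i. N +> x i)"
        using X v unfolding is_basis_def by (auto simp: quot_carrier)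
      then have "N +> v = N +> lcomb M n b x" using ql by simp
      then have "v \<ominus> lcomb M n b x \<in> N" using coset_eq_iff[OF N v xl] by simp
      then obtain a where a: "v \<ominus> lcomb M n b x = lcomb M m a y"
        using y unfolding is_basis_def by auto
      have "v = lcomb M m a y \<oplus> lcomb M n b x"
        unfolding a[symmetric] using v xl[of b] by (simp add: MM.M.minus_eq MM.M.a_assoc MM.M.l_neg)
      also have "\<dots> = lcomb M (m + n) (\<lambda>i. if i < m then a i else b (i - m)) ?z"
        unfolding z_split by (intro arg_cong2[of _ _ _ _ "add M"] lcomb_cong) auto
      finally show ?thesis by blast
    qed
    fix a i assume a: "lcomb M (m + n) a ?z = \<zero>" and i: "i < m + n"
    let ?b = "\<lambda>i. a (m + i)"
    have eq: "lcomb M m a y \<oplus> lcomb M n ?b x = \<zero>" using a z_split by simp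
    have "lcomb M n ?b x = \<ominus> lcomb M m a y"
      using eq xl[of ?b] yl[of a] N.subset by (metis MM.M.a_comm MM.M.minus_equality subsetD)
    then have "lcomb M n ?b x \<in> N"
      using abelian_subgroup.axioms(1)[OF submodule_subgroup[OF N]] additive_subgroup.a_inv_closed yl
      by metis
    then have "lcomb (quot_module M N) n ?b (\<lambda>i. N +> x i) = \<zero>\<^bsub>quot_module M N\<^esub>"
      unfolding ql[symmetric] quot_zero coset_zero_iff[OF N xl] .
    then have b0: "\<And>i. i < n \<Longrightarrow> ?b i = 0" using X unfolding is_basis_def by auto
    then have "lcomb M n ?b x = \<zero>" by (intro lcomb_zero) (auto intro: x simp: b0)
    then have "lcomb M m a y = \<zero>" using eq yl N.subset by (metis MM.M.r_zero subsetD)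
    then have a0: "\<And>i. i < m \<Longrightarrow> a i = 0" using y unfolding is_basis_def by auto
    show "a i = 0" using a0[of i] b0[of "i - m"] i by (cases "i < m") auto
  qed
qed

end

lemma free_filtration_mono:
  fixes M :: "('a::comm_ring_1, 'b) module"
  assumes "free_filtration c M F" "p \<in> {1..c}"
  shows "F (p - 1) \<subseteq> F p"
proof
  fix x assume x: "x \<in> F (p - 1)"
  obtain C where C: "Ssubmodule C M" "F (p - 1) <+>\<^bsub>M\<^esub> C = F p"
    using assms unfolding free_filtration_def by blast
  interpret C: submodule "class_ring :: 'a ring" C M by fact
  interpret M: Smod M using assms unfolding free_filtration_def fg_free_module_def by (intro Smod.intro) auto
  have "p - 1 \<le> c" using assms(2) by auto
  then have "Ssubmodule (F (p - 1)) M" using assms(1) unfolding free_filtration_def by blast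
  then have "x \<in> carrier M" using x submodule.subset by blast
  then have "x = x \<oplus>\<^bsub>M\<^esub> \<zero>\<^bsub>M\<^esub>" by simp
  moreover have "\<zero>\<^bsub>M\<^esub> \<in> C" by simp
  ultimately have "x \<in> F (p - 1) <+>\<^bsub>M\<^esub> C" using x unfolding set_add_def' by blast
  then show "x \<in> F p" using C(2) by simp
qed

lemma submodule_submod:
  fixes M :: "('a::comm_ring_1, 'b) module"
  assumes "Ssubmodule N M" "Ssubmodule L M" "N \<subseteq> L"
  shows "Ssubmodule N (submod M L)"
proof -
  interpret N: submodule "class_ring :: 'a ring" N M by fact
  interpret M: Smod M by (rule Smod.intro) (rule N.module)
  have "Smodule (submod M L)" by (rule M.MM.submodule_is_module[OF assms(2)])
  then show ?thesis
    by (rule submodule.intro) (use assms(3) N.smult_closed in auto)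
qed

lemma is_basis_cong:
  assumes "\<And>i. i < n \<Longrightarrow> x i = y i"
  shows "is_basis M n x \<longleftrightarrow> is_basis M n y"
proof -
  have "lcomb M n a x = lcomb M n a y" for a by (rule lcomb_cong) (auto simp: assms)
  then show ?thesis unfolding is_basis_def by (simp add: assms)
qed

text \<open>In each graded piece choose a basis whose length is the least possible one.  This makes the lengths
  agree with \<^const>\<open>free_rank\<close> by definition, and the lifts are collected level by level.\<close>

lemma adapted_basis_exists:
  fixes M :: "('a::comm_ring_1, 'b) module"
  assumes fil: "free_filtration c M F"
  obtains xs where "adapted_basis c M F xs"
proof -
  let ?b = "\<lambda>p. free_rank (graded_piece M F p)"
  have M: "Smodule M" using fil unfolding free_filtration_def fg_free_module_def by auto
  interpret M: Smod M by (rule Smod.intro) fact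
  have sub: "\<And>p. p \<le> c \<Longrightarrow> Ssubmodule (F p) M" using fil unfolding free_filtration_def by auto
  have "\<exists>xs. length xs = (\<Sum>q=1..p. ?b q) \<and>
      (\<forall>q\<le>p. ordered_basis (submod M (F q)) (take (\<Sum>r=1..q. ?b r) xs))" if "p \<le> c" for p
    using that
  proof (induction p)
    case 0
    interpret F0: Smod "submod M (F 0)"
      by (rule Smod.intro) (rule M.MM.submodule_is_module[OF sub[OF 0]])
    have "ordered_basis (submod M (F 0)) []"
      unfolding F0.ordered_basis_iff using fil by (auto simp: is_basis_def free_filtration_def)
    then show ?case by (intro exI[of _ "[]"]) auto
  next
    case (Suc p)
    then obtain ys where ys: "length ys = (\<Sum>q=1..p. ?b q)"
      and ys_basis: "\<And>q. q \<le> p \<Longrightarrow> ordered_basis (submod M (F q)) (take (\<Sum>r=1..q. ?b r) ys)"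
      by auto
    let ?L = "submod M (F (Suc p))"
    have FL: "F p \<subseteq> F (Suc p)" using free_filtration_mono[OF fil, of "Suc p"] Suc.prems by auto
    have N: "Ssubmodule (F p) ?L"
      by (rule submodule_submod[OF sub sub FL]) (use Suc.prems in auto)
    interpret L: Smod ?L
      by (rule Smod.intro) (rule M.MM.submodule_is_module[OF sub[OF Suc.prems]])
    interpret N: Smod "submod M (F p)"
      by (rule Smod.intro) (rule M.MM.submodule_is_module[OF sub], use Suc.prems in auto)
    interpret Q: Smod "quot_module ?L (F p)" by (rule Smod.intro) (rule L.quot_Smodule[OF N])
    have graded: "graded_piece M F (Suc p) = quot_module ?L (F p)" by (simp add: graded_piece_def)
    have "fg_free_module (graded_piece M F (Suc p))"
      using fil Suc.prems unfolding free_filtration_def by auto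
    then have "\<exists>n Xs. ordered_basis (graded_piece M F (Suc p)) Xs \<and> length Xs = n"
      unfolding fg_free_module_def by auto
    from LeastI_ex[OF this] obtain Xs
      where Xs: "ordered_basis (graded_piece M F (Suc p)) Xs" "length Xs = ?b (Suc p)"
      unfolding free_rank_def by blast
    have "Xs ! i \<in> (\<lambda>x. F p +>\<^bsub>?L\<^esub> x) ` carrier ?L" if "i < length Xs" for i
      using Xs(1) that unfolding graded Q.ordered_basis_iff is_basis_def L.quot_carrier by simp
    then have "\<forall>i. \<exists>x. i < length Xs \<longrightarrow> x \<in> carrier ?L \<and> Xs ! i = F p +>\<^bsub>?L\<^esub> x"
      by (meson imageE)
    from choice[OF this] obtain x
      where x: "\<And>i. i < length Xs \<Longrightarrow> x i \<in> carrier ?L"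
        and Xs_x: "\<And>i. i < length Xs \<Longrightarrow> Xs ! i = F p +>\<^bsub>?L\<^esub> x i" by blast
    let ?n = "length Xs"
    let ?zs = "ys @ map x [0..<?n]"
    have X: "is_basis (quot_module ?L (F p)) ?n (\<lambda>i. F p +>\<^bsub>?L\<^esub> x i)"
      using Xs(1) unfolding graded Q.ordered_basis_iff
      by (rule is_basis_cong[THEN iffD1, rotated]) (rule Xs_x)
    have "is_basis (submod M (F p)) (length ys) (nth ys)"
      using ys_basis[of p] ys unfolding N.ordered_basis_iff by simp
    then have "is_basis (submod ?L (F p)) (length ys) (nth ys)" by simp
    from L.lift_basis[OF N this X x]
    have "is_basis ?L (length ys + ?n) (\<lambda>i. if i < length ys then ys ! i else x (i - length ys))" .
    then have "is_basis ?L (length ys + ?n) (nth ?zs)"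
      by (rule is_basis_cong[THEN iffD1, rotated]) (auto simp: nth_append)
    then have "is_basis ?L (length ?zs) (nth ?zs)" by simp
    then have zs: "ordered_basis ?L ?zs" by (simp only: L.ordered_basis_iff)
    have len: "length ?zs = (\<Sum>q=1..Suc p. ?b q)" using ys Xs(2) by simp
    show ?case
    proof (intro exI[of _ ?zs] conjI allI impI)
      show "length ?zs = (\<Sum>q=1..Suc p. ?b q)" by (rule len)
      fix q assume q: "q \<le> Suc p"
      show "ordered_basis (submod M (F q)) (take (\<Sum>r=1..q. ?b r) ?zs)"
      proof (cases "q = Suc p")
        case True
        then show ?thesis using zs len by (metis order_refl take_all)
      next
        case False
        then have "q \<le> p" using q by simp
        then have "(\<Sum>r=1..q. ?b r) \<le> length ys" unfolding ys by (intro sum_mono2) auto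
        then show ?thesis using ys_basis[OF \<open>q \<le> p\<close>] by simp
      qed
    qed
  qed
  from this[of c] obtain xs where len: "length xs = (\<Sum>q=1..c. ?b q)"
    and xs: "\<And>q. q \<le> c \<Longrightarrow> ordered_basis (submod M (F q)) (take (\<Sum>r=1..q. ?b r) xs)" by auto
  have "F c = carrier M" using fil unfolding free_filtration_def by simp
  then have "ordered_basis M xs" using xs[of c] len by simp
  then show thesis using that len xs unfolding adapted_basis_def by blast
qed

context Smod begin

lemma lcomb_mem_iff:
  assumes x: "is_basis M n x" and N: "Ssubmodule N M" and xN: "is_basis (submod M N) r x" and "r \<le> n"
  shows "lcomb M n a x \<in> N \<longleftrightarrow> (\<forall>i<n. r \<le> i \<longrightarrow> a i = 0)"
proof
  have xM: "\<And>i. i < n \<Longrightarrow> x i \<in> carrier M" using x by (auto simp: is_basis_def)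
  assume "lcomb M n a x \<in> N"
  then obtain b where b: "lcomb M n a x = lcomb M r b x" using xN by (auto simp: is_basis_def)
  have "lcomb M n (\<lambda>i. if i < r then b i else 0) x = lcomb M r (\<lambda>i. if i < r then b i else 0) x"
    by (rule lcomb_truncate) (use xM assms(4) in auto)
  also have "\<dots> = lcomb M r b x" by (rule lcomb_cong) auto
  finally have "lcomb M n a x = lcomb M n (\<lambda>i. if i < r then b i else 0) x" using b by simp
  from basis_unique[OF x this] show "\<forall>i<n. r \<le> i \<longrightarrow> a i = 0" by auto
next
  have xM: "\<And>i. i < n \<Longrightarrow> x i \<in> carrier M" using x by (auto simp: is_basis_def)
  assume "\<forall>i<n. r \<le> i \<longrightarrow> a i = 0"
  then have "lcomb M n a x = lcomb M r a x"
    by (intro lcomb_truncate) (use xM assms(4) in auto)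
  moreover have "lcomb M r a x \<in> N"
    by (rule lcomb_submodule[OF N]) (use xN in \<open>auto simp: is_basis_def\<close>)
  ultimately show "lcomb M n a x \<in> N" by simp
qed

lemma ideal_mod_quot:
  assumes N: "Ssubmodule N M" and J: "ideal J (class_ring :: 'a ring)"
    and v: "v \<in> ideal_mod J (quot_module M N)"
  obtains w where "w \<in> ideal_mod J M" "v = N +> w"
proof -
  interpret Q: Smod "quot_module M N" by (rule Smod.intro) (rule quot_Smodule[OF N])
  interpret I: submodule "class_ring :: 'a ring" "ideal_mod J M" M by (rule ideal_mod_subset)
  have "\<exists>w. w \<in> ideal_mod J M \<and> v = N +> w"
    using J v
  proof (induction rule: Q.ideal_mod_induct)
    case zero
    have "N +> \<zero> = N"
      using coset_zero_iff[OF N MM.M.zero_closed] submodule.zero_closed[OF N] by simp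
    then show ?case using I.zero_closed by (metis quot_zero)
  next
    case (add u v)
    then obtain x y where "x \<in> ideal_mod J M" "y \<in> ideal_mod J M" "u = N +> x" "v = N +> y" by blast
    then show ?case using I.subset quot_add[OF N, of x y] by (intro exI[of _ "x \<oplus> y"]) auto
  next
    case (smult s X)
    then obtain x where "x \<in> carrier M" "X = N +> x" by (auto simp: quot_carrier)
    then show ?case using smult(1) quot_smult[OF N, of x s] ideal_mod_subset(3)[of s J x] by auto
  qed
  then show thesis using that by blast
qed

end

lemma Shom_ideal_mod:
  fixes M :: "('a::comm_ring_1, 'b) module" and N :: "('a, 'c) module"
  assumes M: "Smodule M" and N: "Smodule N" and g: "g \<in> Shom M N"
    and J: "ideal J (class_ring :: 'a ring)" and v: "v \<in> ideal_mod J M"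
  shows "g v \<in> ideal_mod J N"
proof -
  interpret M: Smod M by (rule Smod.intro) fact
  interpret N: Smod N by (rule Smod.intro) fact
  interpret g: mod_hom "class_ring :: 'a ring" M N g
    by (rule mod_hom.intro) (use M N g in \<open>auto simp: mod_hom_axioms_def\<close>)
  interpret I: submodule "class_ring :: 'a ring" "ideal_mod J N" N by (rule N.ideal_mod_subset)
  show ?thesis
    using J v
    by (induction rule: M.ideal_mod_induct) (auto intro: N.ideal_mod_subset(3))
qed

lemma Shom_comp:
  "g \<in> Shom M N \<Longrightarrow> g' \<in> Shom N L \<Longrightarrow> (\<lambda>x. g' (g x)) \<in> Shom M L"
  unfolding LinearCombinations.module_hom_def by (auto simp: Pi_iff)

section \<open>The direct sum of the Koszul blocks\<close>

text \<open>The places \<open>(i, j)\<close> at which row \<open>i\<close> of the Koszul blocks contains \<open>f\<^sub>j\<close>: row \<open>i\<close> is in the block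
  \<open>p\<close> with \<open>N (p - 1) \<le> i < N p\<close>, and \<open>j < p\<close> is equivalent to \<open>N j \<le> i\<close>.\<close>

definition block_positions :: "(nat \<Rightarrow> nat) \<Rightarrow> nat \<Rightarrow> (nat \<times> nat) set" where
  "block_positions N c = {(i, j). 1 \<le> j \<and> N j \<le> i \<and> i < N c}"

text \<open>Every column consists of zeros and of one of the \<open>f\<^sub>j\<close>, and \<open>\<sigma>\<close> sends the column to the place of
  this entry.  The blocks are added one at a time at the lower right corner.\<close>

lemma koszul_blocks_columns:
  fixes f :: "nat \<Rightarrow> 'a::comm_ring_1" and b :: "nat \<Rightarrow> nat" and c :: nat
  defines "N \<equiv> \<lambda>p. \<Sum>q=1..p. b q"
  defines "K \<equiv> diag_block_mat (map (\<lambda>p. koszul_block f p (b p)) [1..<c + 1])"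
  shows "K \<in> carrier_mat (N c) (\<Sum>p=1..c. (p - 1) * b p) \<and>
    (\<exists>\<sigma>. bij_betw \<sigma> {..<dim_col K} (block_positions N c) \<and>
      (\<forall>i<N c. \<forall>k<dim_col K. K $$ (i, k) = (if fst (\<sigma> k) = i then f (snd (\<sigma> k)) else 0)))"
  unfolding K_def
proof (induction c)
  case 0
  show ?case by (auto simp: N_def block_positions_def bij_betw_def)
next
  case (Suc c)
  let ?K = "diag_block_mat (map (\<lambda>p. koszul_block f p (b p)) [1..<c + 1])"
  let ?r = "b (Suc c)"
  let ?B = "koszul_block f (Suc c) ?r"
  let ?K' = "diag_block_mat (map (\<lambda>p. koszul_block f p (b p)) [1..<Suc c + 1])"
  let ?n = "N c" and ?m = "\<Sum>p=1..c. (p - 1) * b p"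
  obtain \<sigma> where K: "?K \<in> carrier_mat ?n ?m"
    and \<sigma>: "bij_betw \<sigma> {..<dim_col ?K} (block_positions N c)"
    and entries: "\<And>i k. i < ?n \<Longrightarrow> k < dim_col ?K \<Longrightarrow>
      ?K $$ (i, k) = (if fst (\<sigma> k) = i then f (snd (\<sigma> k)) else 0)"
    using Suc by auto
  have dims: "dim_row ?K = ?n" "dim_col ?K = ?m" using K by auto
  have B: "?B \<in> carrier_mat ?r (?r * c)" by (simp add: koszul_block_def)
  have N: "N (Suc c) = ?n + ?r" by (simp add: N_def)
  have K': "?K' = four_block_mat ?K (0\<^sub>m ?n (?r * c)) (0\<^sub>m ?r ?m) ?B"
  proof -
    have "map (\<lambda>p. koszul_block f p (b p)) [1..<Suc c + 1] =
      map (\<lambda>p. koszul_block f p (b p)) [1..<c + 1] @ [?B]" by simp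
    then show ?thesis using dims B by (simp only: diag_block_mat_last Let_def carrier_matD)
  qed
  have dim': "dim_col ?K' = ?m + ?r * c" "dim_row ?K' = ?n + ?r"
    unfolding K' using dims B by simp_all
  define \<sigma>' where "\<sigma>' k = (if k < ?m then \<sigma> k else (?n + (k - ?m) div c, (k - ?m) mod c + 1))" for k
  have mono: "N i \<le> N j" if "i \<le> j" for i j
    unfolding N_def using that by (intro sum_mono2) auto
  \<comment> \<open>in the new block the group of \<open>c\<close> columns numbered \<open>s\<close> belongs to row \<open>s\<close>\<close>
  have new: "bij_betw \<sigma>' {?m..<?m + ?r * c} ({?n..<?n + ?r} \<times> {1..c})"
  proof (rule bij_betw_byWitness[where f' = "\<lambda>(i, j). ?m + (i - ?n) * c + (j - 1)"])
    show "\<forall>k\<in>{?m..<?m + ?r * c}. (case \<sigma>' k of (i, j) \<Rightarrow> ?m + (i - ?n) * c + (j - 1)) = k"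
      by (auto simp: \<sigma>'_def)
    show "\<forall>ij\<in>{?n..<?n + ?r} \<times> {1..c}. \<sigma>' (case ij of (i, j) \<Rightarrow> ?m + (i - ?n) * c + (j - 1)) = ij"
    proof
      fix ij assume "ij \<in> {?n..<?n + ?r} \<times> {1..c}"
      then obtain s t where ij: "ij = (?n + s, Suc t)" "t < c"
        by (cases ij) (auto simp: le_iff_add Suc_le_eq less_iff_Suc_add)
      then have "s * c + t - s * c = t" "(s * c + t) div c = s" "(s * c + t) mod c = t" by auto
      then show "\<sigma>' (case ij of (i, j) \<Rightarrow> ?m + (i - ?n) * c + (j - 1)) = ij"
        unfolding ij by (simp add: \<sigma>'_def)
    qed
    show "\<sigma>' ` {?m..<?m + ?r * c} \<subseteq> {?n..<?n + ?r} \<times> {1..c}"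
    proof safe
      fix k i j assume k: "k \<in> {?m..<?m + ?r * c}" and ij: "(i, j) = \<sigma>' k"
      have c: "0 < c" using k by (cases c) auto
      have "k - ?m < ?r * c" using k by auto
      then have "(k - ?m) div c < ?r" by (rule less_mult_imp_div_less)
      then show "i \<in> {?n..<?n + ?r}" using k ij by (auto simp: \<sigma>'_def)
      show "j \<in> {1..c}" using k ij c by (auto simp: \<sigma>'_def Suc_le_eq)
    qed
    show "(\<lambda>(i, j). ?m + (i - ?n) * c + (j - 1)) ` ({?n..<?n + ?r} \<times> {1..c}) \<subseteq> {?m..<?m + ?r * c}"
    proof safe
      fix i j assume "i \<in> {?n..<?n + ?r}" "j \<in> {1..c}"
      then have "(i - ?n) * c + (j - 1) < Suc (i - ?n) * c" by auto
      also have "Suc (i - ?n) * c \<le> ?r * c" using \<open>i \<in> _\<close> by (intro mult_le_mono1) auto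
      finally show "?m + (i - ?n) * c + (j - 1) \<in> {?m..<?m + ?r * c}" by simp
    qed
  qed
  have "bij_betw \<sigma>' {..<?m} (block_positions N c)"
    using \<sigma> unfolding dims by (rule bij_betw_cong[THEN iffD1, rotated]) (simp add: \<sigma>'_def)
  then have "bij_betw \<sigma>' ({..<?m} \<union> {?m..<?m + ?r * c}) (block_positions N c \<union> {?n..<?n + ?r} \<times> {1..c})"
    using new by (rule bij_betw_combine) (auto simp: block_positions_def)
  moreover have "{..<?m} \<union> {?m..<?m + ?r * c} = {..<dim_col ?K'}" unfolding dim' by auto
  moreover have "block_positions N c \<union> {?n..<?n + ?r} \<times> {1..c} = block_positions N (Suc c)"
  proof -
    have "j \<le> c" if "N j \<le> i" "i < N (Suc c)" for i j
      using that mono[of "Suc c" j] by (cases "j \<le> c") auto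
    then show ?thesis using mono[of _ c] unfolding block_positions_def N[symmetric]
      using N by fastforce
  qed
  ultimately have "bij_betw \<sigma>' {..<dim_col ?K'} (block_positions N (Suc c))" by simp
  moreover have "?K' $$ (i, k) = (if fst (\<sigma>' k) = i then f (snd (\<sigma>' k)) else 0)"
    if i: "i < N (Suc c)" and k: "k < dim_col ?K'" for i k
  proof (cases "k < ?m")
    case True
    then have "\<sigma> k \<in> block_positions N c" using \<sigma> dims by (auto simp: bij_betw_def)
    then have "fst (\<sigma> k) < ?n" by (auto simp: block_positions_def)
    then show ?thesis using True i k entries[of i k] dims B N unfolding dim' K'
      by (auto simp: \<sigma>'_def)
  next
    case False
    then show ?thesis using i k dims B N unfolding dim' K'
      by (auto simp: \<sigma>'_def koszul_block_def)
  qed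
  moreover have "?K' \<in> carrier_mat (N (Suc c)) (\<Sum>p=1..Suc c. (p - 1) * b p)"
    using dim' N by (intro carrier_matI) (simp_all add: mult.commute)
  ultimately show ?case by blast
qed

lemma koszul_blocks_mult_vec:
  fixes f :: "nat \<Rightarrow> 'a::comm_ring_1" and b :: "nat \<Rightarrow> nat" and c :: nat
  defines "N \<equiv> \<lambda>p. \<Sum>q=1..p. b q"
  defines "K \<equiv> diag_block_mat (map (\<lambda>p. koszul_block f p (b p)) [1..<c + 1])"
  obtains \<sigma> where "bij_betw \<sigma> {..<dim_col K} (block_positions N c)"
    and "\<And>\<beta> i. i < N c \<Longrightarrow> (\<And>i j. (i, j) \<notin> block_positions N c \<Longrightarrow> \<beta> i j = 0) \<Longrightarrow>
      (\<Sum>k<dim_col K. K $$ (i, k) * \<beta> (fst (\<sigma> k)) (snd (\<sigma> k))) = (\<Sum>j=1..c. f j * \<beta> i j)"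
proof -
  obtain \<sigma> where \<sigma>: "bij_betw \<sigma> {..<dim_col K} (block_positions N c)"
    and entries: "\<And>i k. i < N c \<Longrightarrow> k < dim_col K \<Longrightarrow>
      K $$ (i, k) = (if fst (\<sigma> k) = i then f (snd (\<sigma> k)) else 0)"
    using koszul_blocks_columns[where f = f and b = b and c = c] unfolding N_def K_def by blast
  have mono: "N i \<le> N j" if "i \<le> j" for i j
    unfolding N_def using that by (intro sum_mono2) auto
  have sub: "block_positions N c \<subseteq> {..<N c} \<times> {1..c}"
    using mono[of c] unfolding block_positions_def by (auto simp: not_le[symmetric]) (meson le_trans nat_le_linear)
  have "(\<Sum>k<dim_col K. K $$ (i, k) * \<beta> (fst (\<sigma> k)) (snd (\<sigma> k))) = (\<Sum>j=1..c. f j * \<beta> i j)"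
    if i: "i < N c" and \<beta>: "\<And>i j. (i, j) \<notin> block_positions N c \<Longrightarrow> \<beta> i j = 0" for \<beta> i
  proof -
    let ?g = "\<lambda>(i', j). if i' = i then f j * \<beta> i' j else 0"
    have "(\<Sum>k<dim_col K. K $$ (i, k) * \<beta> (fst (\<sigma> k)) (snd (\<sigma> k))) = (\<Sum>k<dim_col K. ?g (\<sigma> k))"
      by (rule sum.cong) (auto simp: entries i split: prod.splits)
    also have "\<dots> = sum ?g (block_positions N c)" by (rule sum.reindex_bij_betw[OF \<sigma>])
    also have "\<dots> = sum ?g ({..<N c} \<times> {1..c})"
      using sub \<beta> by (intro sum.mono_neutral_left) auto
    also have "\<dots> = (\<Sum>i'<N c. \<Sum>j=1..c. ?g (i', j))" by (simp add: sum.cartesian_product)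
    also have "\<dots> = (\<Sum>i'<N c. if i' = i then (\<Sum>j=1..c. f j * \<beta> i j) else 0)"
      by (intro sum.cong) auto
    also have "\<dots> = (\<Sum>j=1..c. f j * \<beta> i j)" using i by (simp add: sum.delta)
    finally show ?thesis .
  qed
  then show thesis using \<sigma> that by blast
qed

context coordinate_hmf begin

text \<open>The order is that of the columns of the concatenated matrix; \<open>\<sigma>\<close> is the numbering of the Koszul columns
  by places.\<close>

definition assemble :: "(nat \<Rightarrow> nat \<times> nat) \<Rightarrow> nat \<Rightarrow> (nat \<Rightarrow> 'a) \<Rightarrow> (nat \<Rightarrow> nat \<Rightarrow> 'a) \<Rightarrow> 'a vec" where
  "assemble \<sigma> l a \<beta> = vec (N1 c + l)
     (\<lambda>k. if k < N1 c then a k else case \<sigma> (k - N1 c) of (i, j) \<Rightarrow> \<beta> i j)"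

lemma level_coeffs_block_positions:
  "level_coeffs c J a \<beta> \<Longrightarrow> (i, j) \<notin> block_positions N0 c \<Longrightarrow> \<beta> i j = 0"
  unfolding level_coeffs_def block_positions_def by blast

lemma assemble_surj:
  assumes \<sigma>: "bij_betw \<sigma> {..<l} (block_positions N0 c)" and w: "w \<in> carrier_vec (N1 c + l)"
  obtains a \<beta> where "level_coeffs c UNIV a \<beta>" "w = assemble \<sigma> l a \<beta>"
proof -
  let ?S = "block_positions N0 c"
  define a where "a k = (if k < N1 c then w $ k else 0)" for k
  define \<beta> where "\<beta> i j = (if (i, j) \<in> ?S then w $ (N1 c + the_inv_into {..<l} \<sigma> (i, j)) else 0)" for i j
  have "w $ k = (case \<sigma> (k - N1 c) of (i, j) \<Rightarrow> \<beta> i j)" if "N1 c \<le> k" "k < N1 c + l" for k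
  proof -
    have k: "k - N1 c \<in> {..<l}" using that by auto
    then have "\<sigma> (k - N1 c) \<in> ?S" "the_inv_into {..<l} \<sigma> (\<sigma> (k - N1 c)) = k - N1 c"
      using \<sigma> by (auto simp: bij_betw_def the_inv_into_f_f)
    then show ?thesis using that by (auto simp: \<beta>_def split: prod.split)
  qed
  then have "w = assemble \<sigma> l a \<beta>"
    using w by (intro eq_vecI) (auto simp: assemble_def a_def)
  moreover have "level_coeffs c UNIV a \<beta>"
    unfolding level_coeffs_def a_def \<beta>_def block_positions_def by auto
  ultimately show thesis using that by blast
qed

lemma mult_assemble:
  assumes Dm: "Dm = mat (N0 c) (N1 c) (\<lambda>(i, k). D i k)" and K: "dim_row K = N0 c"
    and mult_K: "\<And>\<beta> i. i < N0 c \<Longrightarrow> (\<And>i j. (i, j) \<notin> block_positions N0 c \<Longrightarrow> \<beta> i j = 0) \<Longrightarrow>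
      (\<Sum>k<dim_col K. K $$ (i, k) * \<beta> (fst (\<sigma> k)) (snd (\<sigma> k))) = (\<Sum>j=1..c. f j * \<beta> i j)"
    and lc: "level_coeffs c J a \<beta>"
  shows "concat_cols Dm K *\<^sub>v assemble \<sigma> (dim_col K) a \<beta> = vec (N0 c) (\<lambda>i. Dmap a i + Kmap \<beta> i)"
proof (rule eq_vecI)
  let ?P = "concat_cols Dm K" and ?w = "assemble \<sigma> (dim_col K) a \<beta>"
  let ?m = "N1 c" and ?l = "dim_col K"
  fix i assume "i < dim_vec (vec (N0 c) (\<lambda>i. Dmap a i + Kmap \<beta> i))"
  then have i: "i < N0 c" by simp
  have "(?P *\<^sub>v ?w) $ i = (\<Sum>k\<in>{0..<?m + ?l}. ?P $$ (i, k) * ?w $ k)"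
    using i Dm K by (simp add: scalar_prod_def assemble_def concat_cols_def)
  also have "\<dots> = (\<Sum>k\<in>{0..<?m}. ?P $$ (i, k) * ?w $ k) + (\<Sum>k\<in>{?m..<?m + ?l}. ?P $$ (i, k) * ?w $ k)"
    by (rule sum.atLeastLessThan_concat[symmetric]) auto
  also have "(\<Sum>k\<in>{0..<?m}. ?P $$ (i, k) * ?w $ k) = Dmap a i"
    unfolding Dmap_def atLeast0LessThan using i Dm K
    by (intro sum.cong) (auto simp: assemble_def concat_cols_def)
  also have "(\<Sum>k\<in>{?m..<?m + ?l}. ?P $$ (i, k) * ?w $ k) = (\<Sum>k<?l. ?P $$ (i, k + ?m) * ?w $ (k + ?m))"
    using sum.shift_bounds_nat_ivl[of "\<lambda>k. ?P $$ (i, k) * ?w $ k" 0 ?m ?l]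
    by (simp add: atLeast0LessThan add.commute)
  also have "\<dots> = (\<Sum>k<?l. K $$ (i, k) * \<beta> (fst (\<sigma> k)) (snd (\<sigma> k)))"
    using i Dm K by (intro sum.cong) (auto simp: assemble_def concat_cols_def split: prod.split)
  also have "\<dots> = Kmap \<beta> i"
    unfolding Kmap_def by (rule mult_K[OF i level_coeffs_block_positions[OF lc]])
  finally show "(?P *\<^sub>v ?w) $ i = vec (N0 c) (\<lambda>i. Dmap a i + Kmap \<beta> i) $ i" using i by simp
qed (use Dm K in \<open>simp add: concat_cols_def\<close>)

end

section \<open>The coordinates of a higher matrix factorization\<close>

locale adapted_hmf = higher_matrix_factorization f c A0 F0 A1 F1 d h
  for f :: "nat \<Rightarrow> 'a::comm_ring_1" and c :: nat
    and A0 :: "('a, 'b) module" and F0 :: "nat \<Rightarrow> 'b set"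
    and A1 :: "('a, 'c) module" and F1 :: "nat \<Rightarrow> 'c set"
    and d :: "'c \<Rightarrow> 'b" and h :: "(nat \<Rightarrow> 'b) \<Rightarrow> 'c" +
  fixes xs :: "'c list" and ys :: "'b list"
  assumes xs: "adapted_basis c A1 F1 xs" and ys: "adapted_basis c A0 F0 ys"
begin

definition N0 :: "nat \<Rightarrow> nat" where "N0 p = (\<Sum>q=1..p. free_rank (graded_piece A0 F0 q))"

definition N1 :: "nat \<Rightarrow> nat" where "N1 p = (\<Sum>q=1..p. free_rank (graded_piece A1 F1 q))"

lemma mono_N: "mono N0" "mono N1"
  unfolding N0_def N1_def by (auto intro!: monoI sum_mono2)

lemma length_basis: "length ys = N0 c" "length xs = N1 c"
  using xs ys by (auto simp: adapted_basis_def N0_def N1_def)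

sublocale A0: Smod A0
  using filtration0 by (intro Smod.intro) (auto simp: free_filtration_def fg_free_module_def)

sublocale A1: Smod A1
  using filtration1 by (intro Smod.intro) (auto simp: free_filtration_def fg_free_module_def)

lemma F_submodule: "p \<le> c \<Longrightarrow> Ssubmodule (F0 p) A0" "p \<le> c \<Longrightarrow> Ssubmodule (F1 p) A1"
  using filtration0 filtration1 by (auto simp: free_filtration_def)

lemma F_Smod: "p \<le> c \<Longrightarrow> Smod (submod A0 (F0 p))" "p \<le> c \<Longrightarrow> Smod (submod A1 (F1 p))"
  by (auto intro!: Smod.intro A0.MM.submodule_is_module A1.MM.submodule_is_module F_submodule)

lemma y_basis: "is_basis A0 (N0 c) (nth ys)"
  using ys A0.ordered_basis_iff length_basis by (auto simp: adapted_basis_def)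

lemma x_basis: "is_basis A1 (N1 c) (nth xs)"
  using xs A1.ordered_basis_iff length_basis by (auto simp: adapted_basis_def)

lemma y_level_basis:
  assumes p: "p \<le> c" shows "is_basis (submod A0 (F0 p)) (N0 p) (nth ys)"
proof -
  interpret F: Smod "submod A0 (F0 p)" by (rule F_Smod[OF p])
  have "N0 p \<le> length ys" using monoD[OF mono_N(1) p] length_basis by simp
  moreover have "is_basis (submod A0 (F0 p)) (length (take (N0 p) ys)) (nth (take (N0 p) ys))"
    using ys p F.ordered_basis_iff[of "take (N0 p) ys"] by (auto simp: adapted_basis_def N0_def)
  ultimately show ?thesis
    using is_basis_cong[of "N0 p" "nth (take (N0 p) ys)" "nth ys" "submod A0 (F0 p)"] by (simp add: min_absorb2)
qed

lemma x_level_basis: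
  assumes p: "p \<le> c" shows "is_basis (submod A1 (F1 p)) (N1 p) (nth xs)"
proof -
  interpret F: Smod "submod A1 (F1 p)" by (rule F_Smod[OF p])
  have "N1 p \<le> length xs" using monoD[OF mono_N(2) p] length_basis by simp
  moreover have "is_basis (submod A1 (F1 p)) (length (take (N1 p) xs)) (nth (take (N1 p) xs))"
    using xs p F.ordered_basis_iff[of "take (N1 p) xs"] by (auto simp: adapted_basis_def N1_def)
  ultimately show ?thesis
    using is_basis_cong[of "N1 p" "nth (take (N1 p) xs)" "nth xs" "submod A1 (F1 p)"] by (simp add: min_absorb2)
qed

lemma y_carrier: "i < N0 c \<Longrightarrow> ys ! i \<in> carrier A0"
  using y_basis by (auto simp: is_basis_def)

lemma x_carrier: "k < N1 c \<Longrightarrow> xs ! k \<in> carrier A1"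
  using x_basis by (auto simp: is_basis_def)

lemma lcomb_F0_iff:
  "p \<le> c \<Longrightarrow> lcomb A0 (N0 c) a (nth ys) \<in> F0 p \<longleftrightarrow> (\<forall>i<N0 c. N0 p \<le> i \<longrightarrow> a i = 0)"
  by (intro A0.lcomb_mem_iff y_basis F_submodule y_level_basis monoD[OF mono_N(1)])

lemma lcomb_F1_iff:
  "p \<le> c \<Longrightarrow> lcomb A1 (N1 c) a (nth xs) \<in> F1 p \<longleftrightarrow> (\<forall>k<N1 c. N1 p \<le> k \<longrightarrow> a k = 0)"
  by (intro A1.lcomb_mem_iff x_basis F_submodule x_level_basis monoD[OF mono_N(2)])

definition D :: "nat \<Rightarrow> nat \<Rightarrow> 'a" where
  "D i k = (if i < N0 c \<and> k < N1 c then (SOME a. d (xs ! k) = lcomb A0 (N0 c) a (nth ys)) i else 0)"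

lemma d_closed: "x \<in> carrier A1 \<Longrightarrow> d x \<in> carrier A0"
  using LinearCombinations.module_hom_closed[OF d_hom] by auto

lemma d_x: "k < N1 c \<Longrightarrow> d (xs ! k) = lcomb A0 (N0 c) (\<lambda>i. D i k) (nth ys)"
proof -
  assume k: "k < N1 c"
  have "\<exists>a. d (xs ! k) = lcomb A0 (N0 c) a (nth ys)"
    using d_closed[OF x_carrier[OF k]] y_basis by (auto simp: is_basis_def)
  from someI_ex[OF this] show ?thesis
    by (rule trans) (rule lcomb_cong, auto simp: D_def k)
qed

lemma d_lcomb:
  "d (lcomb A1 (N1 c) a (nth xs)) = lcomb A0 (N0 c) (\<lambda>i. \<Sum>k<N1 c. D i k * a k) (nth ys)"
proof -
  have "d (lcomb A1 (N1 c) a (nth xs)) = lcomb A0 (N1 c) a (\<lambda>k. d (xs ! k))"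
    by (rule Shom_lcomb[OF A1.Smod A0.Smod d_hom]) (rule x_carrier)
  also have "\<dots> = lcomb A0 (N1 c) a (\<lambda>k. lcomb A0 (N0 c) (\<lambda>i. D i k) (nth ys))"
    by (rule lcomb_cong) (auto simp: d_x)
  also have "\<dots> = lcomb A0 (N0 c) (\<lambda>i. \<Sum>k<N1 c. D i k * a k) (nth ys)"
    by (rule A0.lcomb_lcomb) (rule y_carrier)
  finally show ?thesis .
qed

text \<open>The map \<open>h\<^sub>p\<close>, the restriction of \<open>h\<close> to the \<open>p\<close>-th summand.\<close>

definition h_at :: "nat \<Rightarrow> 'b \<Rightarrow> 'c" where
  "h_at p v = h (\<lambda>q. if q = p then v else \<zero>\<^bsub>A0\<^esub>)"

lemma h_at_mem:
  assumes p: "p \<in> {1..c}" and v: "v \<in> F0 p"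
  shows "h_at p v \<in> F1 p"
proof -
  have "\<zero>\<^bsub>A0\<^esub> \<in> F0 q" if "q \<in> {1..p}" for q
    using submodule.zero_closed[OF F_submodule(1), of q] that p by auto
  then have "(\<lambda>q. if q = p then v else \<zero>\<^bsub>A0\<^esub>) \<in> carrier (filtered_sum A0 F0 p)"
    using v p by (auto simp: filtered_sum_def)
  then show ?thesis using h_filtered[of p] p unfolding h_at_def by auto
qed

lemma h_at_hom:
  assumes p: "p \<in> {1..c}"
  shows "h_at p \<in> Shom (submod A0 (F0 p)) (submod A1 (F1 p))"
proof -
  let ?S = "filtered_sum A0 F0 c"
  let ?i = "\<lambda>v q. if q = p then v else \<zero>\<^bsub>A0\<^esub>"
  interpret F: submodule "class_ring :: 'a ring" "F0 p" A0 by (rule F_submodule) (use p in auto)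
  have mem: "?i v \<in> carrier ?S" if "v \<in> F0 p" for v
  proof -
    have "\<zero>\<^bsub>A0\<^esub> \<in> F0 q" if "q \<in> {1..c}" for q
      using submodule.zero_closed[OF F_submodule(1), of q] that by auto
    then show ?thesis using that p by (auto simp: filtered_sum_def)
  qed
  have add: "?i (u \<oplus>\<^bsub>A0\<^esub> v) = ?i u \<oplus>\<^bsub>?S\<^esub> ?i v" for u v by (auto simp: filtered_sum_def)
  have smult: "?i (s \<odot>\<^bsub>A0\<^esub> v) = s \<odot>\<^bsub>?S\<^esub> ?i v" for s v by (auto simp: filtered_sum_def)
  show ?thesis
    unfolding LinearCombinations.module_hom_def
  proof (intro CollectI conjI allI impI)
    show "h_at p \<in> carrier (submod A0 (F0 p)) \<rightarrow> carrier (submod A1 (F1 p))"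
      using h_at_mem[OF p] by auto
    show "h_at p (u \<oplus>\<^bsub>submod A0 (F0 p)\<^esub> v) = h_at p u \<oplus>\<^bsub>submod A1 (F1 p)\<^esub> h_at p v"
      if "u \<in> carrier (submod A0 (F0 p)) \<and> v \<in> carrier (submod A0 (F0 p))" for u v
      using that LinearCombinations.module_hom_add[OF h_hom mem mem, of u v] by (simp add: h_at_def add)
    show "h_at p (s \<odot>\<^bsub>submod A0 (F0 p)\<^esub> v) = s \<odot>\<^bsub>submod A1 (F1 p)\<^esub> h_at p v"
      if "s \<in> carrier class_ring \<and> v \<in> carrier (submod A0 (F0 p))" for s v
      using that LinearCombinations.module_hom_smult[OF h_hom _ mem, of s v] by (simp add: h_at_def smult)
  qed
qed

lemma D_filtered:
  assumes p: "p \<le> c" and k: "k < N1 p" and i: "N0 p \<le> i"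
  shows "D i k = 0"
proof (cases "i < N0 c")
  case True
  have kc: "k < N1 c" using k monoD[OF mono_N(2) p] by simp
  have "xs ! k \<in> F1 p" using x_level_basis[OF p] k by (auto simp: is_basis_def)
  then have "d (xs ! k) \<in> F0 p" using d_filtered[OF p] by auto
  then show ?thesis using lcomb_F0_iff[OF p, of "\<lambda>i. D i k"] d_x[OF kc] True i by auto
qed (simp add: D_def)

text \<open>Condition (a): take for \<open>z\<close> the coordinates of \<open>h\<^sub>p x\<close>.\<close>

lemma D_h_coordinates:
  assumes p: "p \<in> {1..c}" and x: "\<forall>i\<ge>N0 p. x i = 0"
  shows "\<exists>z. (\<forall>k\<ge>N1 p. z k = 0) \<and>
     (\<forall>i. (\<Sum>k<N1 c. D i k * z k) - f p * x i \<in> seq_ideal f (p - 1))"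
proof -
  let ?J = "seq_ideal f (p - 1)" and ?v = "lcomb A0 (N0 c) x (nth ys)"
  have pc: "p \<le> c" using p by simp
  have v: "?v \<in> F0 p" using x lcomb_F0_iff[OF pc] by auto
  have hv: "h_at p ?v \<in> F1 p" by (rule h_at_mem[OF p v])
  then have "h_at p ?v \<in> carrier A1" using submodule.subset[OF F_submodule(2)[OF pc]] by auto
  then obtain z where z: "h_at p ?v = lcomb A1 (N1 c) z (nth xs)" using x_basis by (auto simp: is_basis_def)
  define z' where "z' k = (if k < N1 c then z k else 0)" for k
  have hz: "h_at p ?v = lcomb A1 (N1 c) z' (nth xs)" unfolding z by (rule lcomb_cong) (auto simp: z'_def)
  then have z'0: "\<forall>k\<ge>N1 p. z' k = 0"
    using hv lcomb_F1_iff[OF pc, of z'] by (auto simp: z'_def)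
  have "d (h_at p ?v) \<ominus>\<^bsub>A0\<^esub> (f p \<odot>\<^bsub>A0\<^esub> ?v) \<in> ideal_mod ?J (submod A0 (F0 p))"
    using d_h[of p ?v] v p unfolding h_at_def by auto
  then have "d (h_at p ?v) \<ominus>\<^bsub>A0\<^esub> (f p \<odot>\<^bsub>A0\<^esub> ?v) \<in> ideal_mod ?J A0"
    using ideal_mod_submod[OF A0.Smod F_submodule(1)[OF pc] seq_ideal_ideal] by auto
  moreover have "d (h_at p ?v) \<ominus>\<^bsub>A0\<^esub> (f p \<odot>\<^bsub>A0\<^esub> ?v) =
      lcomb A0 (N0 c) (\<lambda>i. (\<Sum>k<N1 c. D i k * z' k) - f p * x i) (nth ys)"
    unfolding hz d_lcomb using y_carrier by (simp add: A0.lcomb_minus A0.lcomb_smult)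
  ultimately have "\<forall>i<N0 c. (\<Sum>k<N1 c. D i k * z' k) - f p * x i \<in> ?J"
    by (simp only: A0.lcomb_in_ideal_mod_iff[OF seq_ideal_ideal y_basis])
  moreover have "(\<Sum>k<N1 c. D i k * z' k) - f p * x i = 0" if "\<not> i < N0 c" for i
    using that x monoD[OF mono_N(1) pc] by (simp add: D_def)
  ultimately have "(\<Sum>k<N1 c. D i k * z' k) - f p * x i \<in> ?J" for i
    using class_ideal_closed(1)[OF seq_ideal_ideal[of f "p - 1"]] by (cases "i < N0 c") simp_all
  then show ?thesis using z'0 by blast
qed

text \<open>Condition (b).  If \<open>d(u)\<close> has coordinates in \<open>J = (f\<^sub>1, \<dots>, f\<^sub>p\<^sub>-\<^sub>1)\<close>, then so has \<open>h\<^sub>p d(u)\<close> by linearity,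
  and this element agrees with \<open>f\<^sub>p u\<close> in the graded piece up to an element with coordinates in \<open>J\<close>.
  Coordinates in the graded piece are those from \<open>N1 (p - 1)\<close> on.\<close>

lemma h_D_coordinates:
  assumes p: "p \<in> {1..c}" and a: "\<forall>k\<ge>N1 p. a k = 0"
    and Da: "\<forall>i. (\<Sum>k<N1 c. D i k * a k) \<in> seq_ideal f (p - 1)"
    and k: "N1 (p - 1) \<le> k" "k < N1 p"
  shows "f p * a k \<in> seq_ideal f (p - 1)"
proof -
  let ?J = "seq_ideal f (p - 1)" and ?L = "submod A1 (F1 p)" and ?E = "submod A0 (F0 p)"
  let ?N = "F1 (p - 1)" and ?r = "N1 p"
  let ?Da = "\<lambda>i. \<Sum>k<N1 c. D i k * a k"
  note J = seq_ideal_ideal[of f "p - 1"]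
  have pc: "p \<le> c" "p - 1 \<le> c" using p by auto
  have r: "?r \<le> N1 c" "N1 (p - 1) \<le> ?r" "N0 p \<le> N0 c" using pc by (auto intro!: monoD[OF mono_N(2)] monoD[OF mono_N(1)])
  interpret L: Smod ?L by (rule F_Smod[OF pc(1)])
  interpret E: Smod ?E by (rule F_Smod[OF pc(1)])
  have N: "Ssubmodule ?N ?L"
    by (rule submodule_submod[OF F_submodule(2) F_submodule(2) free_filtration_mono[OF filtration1 p]])
       (use pc in auto)
  let ?G = "quot_module ?L ?N"
  interpret G: Smod ?G by (rule Smod.intro) (rule L.quot_Smodule[OF N])
  have L_basis: "is_basis ?L ?r (nth xs)" by (rule x_level_basis[OF pc(1)])
  have E_basis: "is_basis ?E (N0 p) (nth ys)" by (rule y_level_basis[OF pc(1)])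
  have xL: "\<And>k. k < ?r \<Longrightarrow> xs ! k \<in> carrier ?L" using L_basis by (auto simp: is_basis_def)
  have lL: "lcomb ?L ?r b (nth xs) \<in> carrier ?L" for b by (rule L.lcomb_closed) (rule xL)
  let ?u = "lcomb ?L ?r a (nth xs)"
  have u: "?u = lcomb A1 (N1 c) a (nth xs)"
    unfolding lcomb_submod by (rule A1.lcomb_truncate[symmetric]) (use x_carrier r a in auto)
  have uF: "?u \<in> F1 p" using lL[of a] by simp
  then have "d ?u \<in> F0 p" using d_filtered[OF pc(1)] by auto
  moreover have du: "d ?u = lcomb A0 (N0 c) ?Da (nth ys)" unfolding u by (rule d_lcomb)
  ultimately have vanish: "\<forall>i<N0 c. N0 p \<le> i \<longrightarrow> ?Da i = 0" using lcomb_F0_iff[OF pc(1), of ?Da] by simp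
  have "lcomb A0 (N0 c) ?Da (nth ys) = lcomb A0 (N0 p) ?Da (nth ys)"
    by (rule A0.lcomb_truncate) (use vanish y_carrier r in auto)
  then have du': "d ?u = lcomb ?E (N0 p) ?Da (nth ys)" using du by simp
  have "h_at p (d ?u) = lcomb ?L (N0 p) ?Da (\<lambda>i. h_at p (ys ! i))"
    unfolding du' by (rule Shom_lcomb[OF E.Smod L.Smod h_at_hom[OF p]])
      (use E_basis in \<open>auto simp: is_basis_def\<close>)
  also have "\<dots> \<in> ideal_mod ?J ?L"
    using E_basis Da h_at_mem[OF p] by (intro L.lcomb_ideal_mod) (auto simp: is_basis_def)
  finally have hdu: "h_at p (d ?u) \<in> ideal_mod ?J ?L" .
  then obtain e where e: "h_at p (d ?u) = lcomb ?L ?r e (nth xs)" "\<forall>k. e k \<in> ?J"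
    using L.ideal_mod_coordinates[OF J hdu L_basis] by blast
  let ?q = "\<lambda>v. ?N +>\<^bsub>?L\<^esub> v"
  have q_minus: "?q (lcomb ?L ?r b (nth xs)) \<ominus>\<^bsub>?G\<^esub> ?q (lcomb ?L ?r b' (nth xs)) =
      ?q (lcomb ?L ?r (\<lambda>k. b k - b' k) (nth xs))" for b b'
  proof -
    have 1: "?q (lcomb ?L ?r b (nth xs)) = lcomb ?G ?r b (\<lambda>k. ?q (xs ! k))" for b
      by (rule L.quot_lcomb[OF N]) (rule xL)
    have "?q (xs ! k) \<in> carrier ?G" if "k < ?r" for k using xL[OF that] by (simp add: L.quot_carrier)
    then show ?thesis unfolding 1 by (intro G.lcomb_minus[symmetric])
  qed
  have fu: "f p \<odot>\<^bsub>?G\<^esub> ?q ?u = ?q (lcomb ?L ?r (\<lambda>k. f p * a k) (nth xs))"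
    using L.quot_smult[OF N lL, of "f p" a] L.lcomb_smult[of ?r "nth xs" "f p" a] xL by simp
  have "?q (h_at p (d ?u)) \<ominus>\<^bsub>?G\<^esub> (f p \<odot>\<^bsub>?G\<^esub> ?q ?u) \<in> ideal_mod ?J ?G"
    using h_d[of p ?u] uF p unfolding h_at_def graded_piece_def by auto
  then have "?q (lcomb ?L ?r (\<lambda>k. e k - f p * a k) (nth xs)) \<in> ideal_mod ?J ?G"
    unfolding fu e(1) q_minus .
  then obtain w where w: "w \<in> ideal_mod ?J ?L"
    "?q (lcomb ?L ?r (\<lambda>k. e k - f p * a k) (nth xs)) = ?q w"
    by (rule L.ideal_mod_quot[OF N J])
  obtain g where g: "w = lcomb ?L ?r g (nth xs)" "\<forall>k. g k \<in> ?J"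
    using L.ideal_mod_coordinates[OF J w(1) L_basis] by blast
  have "lcomb ?L ?r (\<lambda>k. e k - f p * a k) (nth xs) \<ominus>\<^bsub>?L\<^esub> lcomb ?L ?r g (nth xs) \<in> ?N"
    using w(2) unfolding g(1) L.coset_eq_iff[OF N lL lL] .
  moreover have "lcomb ?L ?r (\<lambda>k. e k - f p * a k - g k) (nth xs) =
      lcomb ?L ?r (\<lambda>k. e k - f p * a k) (nth xs) \<ominus>\<^bsub>?L\<^esub> lcomb ?L ?r g (nth xs)"
    by (rule L.lcomb_minus) (rule xL)
  ultimately have mem: "lcomb ?L ?r (\<lambda>k. e k - f p * a k - g k) (nth xs) \<in> ?N" by simp
  have "is_basis (submod ?L ?N) (N1 (p - 1)) (nth xs)"
    using x_level_basis[OF pc(2)] by simp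
  from iffD1[OF L.lcomb_mem_iff[OF L_basis N this r(2)] mem] k
  have "e k - f p * a k - g k = 0" by simp
  then have "f p * a k = e k - g k" by (simp add: algebra_simps)
  then show ?thesis using class_ideal_closed(6)[OF J spec[OF e(2)] spec[OF g(2)]] by simp
qed

lemma coordinate_hmf:
  assumes "weakly_regular f c" shows "coordinate_hmf f c N0 N1 D"
proof
  show "weakly_regular f c" by fact
  show "N0 0 = 0" "N1 0 = 0" by (simp_all add: N0_def N1_def)
  show "mono N0" "mono N1" by (rule mono_N)+
qed (rule D_filtered D_h_coordinates h_D_coordinates, assumption+)+

lemma D_matrix: "matrix_of_hom A0 xs ys d (mat (N0 c) (N1 c) (\<lambda>(i, k). D i k))"
  unfolding matrix_of_hom_def length_basis
proof (intro conjI allI impI)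
  fix k assume k: "k < N1 c"
  have "(\<Oplus>\<^bsub>A0\<^esub>i\<in>{..<N0 c}. (mat (N0 c) (N1 c) (\<lambda>(i, k). D i k) $$ (i, k)) \<odot>\<^bsub>A0\<^esub> ys ! i) =
      lcomb A0 (N0 c) (\<lambda>i. mat (N0 c) (N1 c) (\<lambda>(i, k). D i k) $$ (i, k)) (nth ys)"
    by (rule A0.finsum_lcomb) (rule y_carrier)
  also have "\<dots> = lcomb A0 (N0 c) (\<lambda>i. D i k) (nth ys)" by (rule lcomb_cong) (auto simp: k)
  finally show "d (xs ! k) = (\<Oplus>\<^bsub>A0\<^esub>i\<in>{..<N0 c}. (mat (N0 c) (N1 c) (\<lambda>(i, k). D i k) $$ (i, k)) \<odot>\<^bsub>A0\<^esub> ys ! i)"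
    by (simp add: d_x[OF k])
qed simp

lemma D_in_max_ideal:
  assumes "minimal_hmf c A0 F0 A1 d h" and J: "ideal (max_ideal :: 'a set) (class_ring :: 'a ring)"
    and k: "k < N1 c"
  shows "D i k \<in> max_ideal"
proof (cases "i < N0 c")
  case True
  have "d (xs ! k) \<in> ideal_mod max_ideal A0"
    using assms(1) x_carrier[OF k] unfolding minimal_hmf_def by auto
  then show ?thesis using A0.lcomb_in_ideal_mod_iff[OF J y_basis] d_x[OF k] True by metis
next
  case False
  then show ?thesis using class_ideal_closed(1)[OF J] by (simp add: D_def)
qed

text \<open>The surjection \<open>S\<^sup>n \<cong> A\<^sub>0 \<rightarrow> A\<^sub>0/IA\<^sub>0 \<rightarrow> M\<close>; the two cosets correspond to the base change to \<open>S/I\<close> and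
  to the cokernel.\<close>

definition augmentation :: "'a vec \<Rightarrow> 'b set set" where
  "augmentation v =
     (let I = seq_ideal f c; B = base_change I A0 in
      (base_change_map I A0 d ` carrier (base_change I A1)) +>\<^bsub>B\<^esub>
        (ideal_mod I A0 +>\<^bsub>A0\<^esub> lcomb A0 (N0 c) (vec_index v) (nth ys)))"

text \<open>\<open>M\<close> is a quotient of a quotient: its elements are classes modulo \<open>d(A\<^sub>1) + IA\<^sub>0\<close>, and in coordinates
  \<open>IA\<^sub>0\<close> consists of the vectors with entries in \<open>I\<close>.\<close>

lemma augmentation_hom: "augmentation \<in> Shom (module_vec TYPE('a) (N0 c)) (hmf_module f c A0 A1 d)" (is ?hom)
  and augmentation_surj: "augmentation ` carrier_vec (N0 c) = carrier (hmf_module f c A0 A1 d)" (is ?surj)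
  and augmentation_kernel: "v \<in> carrier_vec (N0 c) \<Longrightarrow>
    augmentation v = \<zero>\<^bsub>hmf_module f c A0 A1 d\<^esub> \<longleftrightarrow>
      (\<exists>a. \<forall>i<N0 c. v $ i - (\<Sum>k<N1 c. D i k * a k) \<in> seq_ideal f c)"
proof -
  let ?I = "seq_ideal f c"
  let ?IA0 = "ideal_mod ?I A0" and ?IA1 = "ideal_mod ?I A1"
  let ?B = "quot_module A0 ?IA0" and ?B1 = "quot_module A1 ?IA1"
  let ?\<pi> = "\<lambda>v. ?IA0 +>\<^bsub>A0\<^esub> v"
  let ?\<phi> = "\<lambda>v. lcomb A0 (N0 c) (vec_index v) (nth ys)"
  let ?T = "base_change_map ?I A0 d ` carrier ?B1"
  note I = seq_ideal_ideal[of f c]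
  have IA0: "Ssubmodule ?IA0 A0" and IA1: "Ssubmodule ?IA1 A1"
    by (rule A0.ideal_mod_subset A1.ideal_mod_subset)+
  interpret B: Smod ?B by (rule Smod.intro) (rule A0.quot_Smodule[OF IA0])
  interpret d: mod_hom "class_ring :: 'a ring" A1 A0 d
    by (rule mod_hom.intro) (use A0.Smod A1.Smod d_hom in \<open>auto simp: mod_hom_axioms_def\<close>)
  have \<pi>: "?\<pi> \<in> Shom A0 ?B" by (rule A0.quot_hom[OF IA0])
  have base_d: "base_change_map ?I A0 d (?IA1 +>\<^bsub>A1\<^esub> x) = ?\<pi> (d x)" if x: "x \<in> carrier A1" for x
    unfolding base_change_map_def
  proof (rule A1.coset_union_const[OF IA1 x])
    fix y assume y: "y \<in> ?IA1 +>\<^bsub>A1\<^esub> x"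
    interpret S: abelian_subgroup ?IA1 A1 by (rule A1.submodule_subgroup[OF IA1])
    have yc: "y \<in> carrier A1" by (rule S.a_elemrcos_carrier[OF x y])
    then have "?IA1 +>\<^bsub>A1\<^esub> y = ?IA1 +>\<^bsub>A1\<^esub> x" using S.a_repr_independence'[OF y x] by simp
    then have "y \<ominus>\<^bsub>A1\<^esub> x \<in> ?IA1" using A1.coset_eq_iff[OF IA1 yc x] by simp
    then have "d (y \<ominus>\<^bsub>A1\<^esub> x) \<in> ?IA0" by (rule Shom_ideal_mod[OF A1.Smod A0.Smod d_hom I])
    then have "d y \<ominus>\<^bsub>A0\<^esub> d x \<in> ?IA0" using x yc by simp
    then show "?\<pi> (d y) = ?\<pi> (d x)" using A0.coset_eq_iff[OF IA0] d_closed x yc by simp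
  qed
  have T: "?T = (\<lambda>x. ?\<pi> (d x)) ` carrier A1"
    unfolding A1.quot_carrier image_image by (rule image_cong) (auto simp: base_d)
  have T_sub: "Ssubmodule ?T ?B"
  proof -
    interpret g: mod_hom "class_ring :: 'a ring" A1 ?B "\<lambda>x. ?\<pi> (d x)"
      by (rule mod_hom.intro) (use A1.Smod B.Smod Shom_comp[OF d_hom \<pi>] in \<open>auto simp: mod_hom_axioms_def\<close>)
    show ?thesis using g.im_is_submodule unfolding T g.im_def .
  qed
  have hmf: "hmf_module f c A0 A1 d = quot_module ?B ?T"
    by (simp add: hmf_module_def Let_def coker_module_def base_change_def)
  have aug: "augmentation = (\<lambda>v. ?T +>\<^bsub>?B\<^esub> ?\<pi> (?\<phi> v))"
    by (rule ext) (simp add: augmentation_def Let_def base_change_def)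
  have \<phi>: "?\<phi> \<in> Shom (module_vec TYPE('a) (N0 c)) A0"
    unfolding LinearCombinations.module_hom_def
  proof (intro CollectI conjI allI impI)
    show "?\<phi> \<in> carrier (module_vec TYPE('a) (N0 c)) \<rightarrow> carrier A0" using y_carrier by auto
    show "?\<phi> (u \<oplus>\<^bsub>module_vec TYPE('a) (N0 c)\<^esub> v) = ?\<phi> u \<oplus>\<^bsub>A0\<^esub> ?\<phi> v"
      if "u \<in> carrier (module_vec TYPE('a) (N0 c)) \<and> v \<in> carrier (module_vec TYPE('a) (N0 c))" for u v
    proof -
      have "?\<phi> (u + v) = lcomb A0 (N0 c) (\<lambda>i. u $ i + v $ i) (nth ys)"
        by (rule lcomb_cong) (use that in \<open>auto simp: module_vec_simps\<close>)
      then show ?thesis using y_carrier by (simp add: module_vec_simps A0.lcomb_add)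
    qed
    show "?\<phi> (s \<odot>\<^bsub>module_vec TYPE('a) (N0 c)\<^esub> v) = s \<odot>\<^bsub>A0\<^esub> ?\<phi> v"
      if "s \<in> carrier class_ring \<and> v \<in> carrier (module_vec TYPE('a) (N0 c))" for s v
    proof -
      have "?\<phi> (s \<cdot>\<^sub>v v) = lcomb A0 (N0 c) (\<lambda>i. s * v $ i) (nth ys)"
        by (rule lcomb_cong) (use that in \<open>auto simp: module_vec_simps\<close>)
      then show ?thesis using y_carrier by (simp add: module_vec_simps A0.lcomb_smult)
    qed
  qed
  show ?hom
    unfolding hmf aug by (rule Shom_comp[OF Shom_comp[OF \<phi> \<pi>] B.quot_hom[OF T_sub]])
  have \<phi>_surj: "?\<phi> ` carrier_vec (N0 c) = carrier A0"
  proof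
    show "?\<phi> ` carrier_vec (N0 c) \<subseteq> carrier A0" using y_carrier by auto
    show "carrier A0 \<subseteq> ?\<phi> ` carrier_vec (N0 c)"
    proof
      fix v assume "v \<in> carrier A0"
      then obtain a where "v = lcomb A0 (N0 c) a (nth ys)" using y_basis by (auto simp: is_basis_def)
      also have "\<dots> = ?\<phi> (vec (N0 c) a)" by (rule lcomb_cong) auto
      finally show "v \<in> ?\<phi> ` carrier_vec (N0 c)" by auto
    qed
  qed
  show ?surj
    unfolding hmf aug B.quot_carrier A0.quot_carrier \<phi>_surj[symmetric] by (simp only: image_image)
  fix v :: "'a vec" assume v: "v \<in> carrier_vec (N0 c)"
  have \<phi>v: "?\<phi> v \<in> carrier A0" using y_carrier by auto
  have "augmentation v = \<zero>\<^bsub>hmf_module f c A0 A1 d\<^esub> \<longleftrightarrow> ?\<pi> (?\<phi> v) \<in> ?T"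
    unfolding hmf aug B.quot_zero by (rule B.coset_zero_iff[OF T_sub]) (use \<phi>v in \<open>auto simp: A0.quot_carrier\<close>)
  also have "\<dots> \<longleftrightarrow> (\<exists>x\<in>carrier A1. ?\<phi> v \<ominus>\<^bsub>A0\<^esub> d x \<in> ?IA0)"
    unfolding T using A0.coset_eq_iff[OF IA0 \<phi>v d_closed] by auto
  also have "\<dots> \<longleftrightarrow> (\<exists>a. ?\<phi> v \<ominus>\<^bsub>A0\<^esub> d (lcomb A1 (N1 c) a (nth xs)) \<in> ?IA0)"
  proof -
    have "carrier A1 = range (\<lambda>a. lcomb A1 (N1 c) a (nth xs))"
      using x_basis x_carrier by (auto simp: is_basis_def image_iff)
    then show ?thesis by (simp add: bex_UNIV)
  qed
  also have "\<dots> \<longleftrightarrow> (\<exists>a. \<forall>i<N0 c. v $ i - (\<Sum>k<N1 c. D i k * a k) \<in> ?I)"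
    unfolding d_lcomb using y_carrier
    by (simp add: A0.lcomb_minus[symmetric] A0.lcomb_in_ideal_mod_iff[OF I y_basis])
  finally show "augmentation v = \<zero>\<^bsub>hmf_module f c A0 A1 d\<^esub> \<longleftrightarrow>
      (\<exists>a. \<forall>i<N0 c. v $ i - (\<Sum>k<N1 c. D i k * a k) \<in> ?I)" .
qed

end

section \<open>The presentation matrix\<close>

theorem corollary3p13:
  fixes f :: "nat \<Rightarrow> 'a::comm_ring_1" and c :: nat
    and A0 :: "('a, 'b) module" and F0 :: "nat \<Rightarrow> 'b set"
    and A1 :: "('a, 'c) module" and F1 :: "nat \<Rightarrow> 'c set"
    and d :: "'c \<Rightarrow> 'b" and h :: "(nat \<Rightarrow> 'b) \<Rightarrow> 'c"
  assumes "noetherian_local_ring (class_ring :: 'a ring)"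
    and "regular_sequence f c"
    and "higher_matrix_factorization f c A0 F0 A1 F1 d h"
    and "minimal_hmf c A0 F0 A1 d h"
  shows "let b = (\<lambda>p. free_rank (graded_piece A0 F0 p));
             n = (\<Sum>p=1..c. b p);
             K = diag_block_mat (map (\<lambda>p. koszul_block f p (b p)) [1..<c + 1])
         in K \<in> carrier_mat n (\<Sum>p=1..c. (p - 1) * b p) \<and>
            (\<exists>xs ys D. adapted_basis c A1 F1 xs \<and> adapted_basis c A0 F0 ys \<and> length ys = n \<and>
               matrix_of_hom A0 xs ys d D \<and>
               minimal_presentation_matrix (concat_cols D K) (hmf_module f c A0 A1 d))"
proof -
  interpret H: higher_matrix_factorization f c A0 F0 A1 F1 d h by fact
  obtain xs where xs: "adapted_basis c A1 F1 xs" using adapted_basis_exists[OF H.filtration1] .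
  obtain ys where ys: "adapted_basis c A0 F0 ys" using adapted_basis_exists[OF H.filtration0] .
  interpret adapted_hmf f c A0 F0 A1 F1 d h xs ys by unfold_locales (fact xs ys)+
  interpret C: coordinate_hmf f c N0 N1 D
    by (rule coordinate_hmf[OF regular_sequence_imp_weakly_regular[OF assms(2)]])
  let ?b = "\<lambda>p. free_rank (graded_piece A0 F0 p)"
  define K where "K = diag_block_mat (map (\<lambda>p. koszul_block f p (?b p)) [1..<c + 1])"
  define Dm where "Dm = mat (N0 c) (N1 c) (\<lambda>(i, k). D i k)"
  let ?M = "max_ideal :: 'a set" and ?P = "concat_cols Dm K" and ?l = "dim_col K"
  have N0_eq: "N0 = (\<lambda>p. \<Sum>q=1..p. ?b q)" by (rule ext) (rule N0_def)
  have K_carrier: "K \<in> carrier_mat (N0 c) (\<Sum>p=1..c. (p - 1) * ?b p)"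
    using koszul_blocks_columns[where f = f and b = ?b and c = c] unfolding K_def N0_eq by blast
  obtain \<sigma> where \<sigma>: "bij_betw \<sigma> {..<?l} (block_positions N0 c)"
    and mult_K: "\<And>\<beta> i. i < N0 c \<Longrightarrow> (\<And>i j. (i, j) \<notin> block_positions N0 c \<Longrightarrow> \<beta> i j = 0) \<Longrightarrow>
      (\<Sum>k<?l. K $$ (i, k) * \<beta> (fst (\<sigma> k)) (snd (\<sigma> k))) = (\<Sum>j=1..c. f j * \<beta> i j)"
    using koszul_blocks_mult_vec[where f = f and b = ?b and c = c] unfolding K_def N0_eq by blast
  have dim_P: "dim_row ?P = N0 c" "dim_col ?P = N1 c + ?l"
    by (simp_all add: concat_cols_def Dm_def)
  have mult: "?P *\<^sub>v C.assemble \<sigma> ?l a \<beta> = vec (N0 c) (\<lambda>i. C.Dmap a i + C.Kmap \<beta> i)"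
    if "C.level_coeffs c J a \<beta>" for J a \<beta>
    by (rule C.mult_assemble[OF Dm_def _ mult_K that]) (use K_carrier in auto)
  have D0: "D i k = 0" if "N0 c \<le> i" for i k using that by (simp add: D_def)
  have M: "ideal ?M (class_ring :: 'a ring)" by (rule local_ring_max_ideal[OF assms(1)])
  have "seq_ideal f c \<subseteq> ?M"
    by (rule local_ring_max_ideal(2)[OF assms(1) seq_ideal_ideal])
       (use assms(2) in \<open>simp add: regular_sequence_def\<close>)
  then have fM: "f j \<in> ?M" if "j \<in> {1..c}" for j using seq_ideal_generator[OF that, of f] by auto
  have DM: "D i k \<in> ?M" if "k < N1 c" for i k by (rule D_in_max_ideal[OF assms(4) M that])
  note Mc = class_ideal_closed[OF M]
  have image: "{v \<in> carrier_vec (N0 c). augmentation v = \<zero>\<^bsub>hmf_module f c A0 A1 d\<^esub>} =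
      (\<lambda>w. ?P *\<^sub>v w) ` carrier_vec (N1 c + ?l)" (is "?ker = ?im")
  proof
    show "?ker \<subseteq> ?im"
    proof
      fix v assume "v \<in> ?ker"
      then have v: "v \<in> carrier_vec (N0 c)" and "augmentation v = \<zero>\<^bsub>hmf_module f c A0 A1 d\<^esub>" by auto
      then obtain a \<beta> where lc: "C.level_coeffs c UNIV a \<beta>"
        and "\<forall>i<N0 c. v $ i = C.Dmap a i + C.Kmap \<beta> i"
        using augmentation_kernel[OF v] C.image_mod_ideal[OF D0] by auto
      then have "v = ?P *\<^sub>v C.assemble \<sigma> ?l a \<beta>" unfolding mult[OF lc] using v by (intro eq_vecI) auto
      moreover have "C.assemble \<sigma> ?l a \<beta> \<in> carrier_vec (N1 c + ?l)" by (simp add: C.assemble_def)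
      ultimately show "v \<in> ?im" by blast
    qed
    show "?im \<subseteq> ?ker"
    proof
      fix v assume "v \<in> ?im"
      then obtain w where w: "w \<in> carrier_vec (N1 c + ?l)" "v = ?P *\<^sub>v w" by blast
      obtain a \<beta> where lc: "C.level_coeffs c UNIV a \<beta>" "w = C.assemble \<sigma> ?l a \<beta>"
        using C.assemble_surj[OF \<sigma> w(1)] .
      have v: "v = vec (N0 c) (\<lambda>i. C.Dmap a i + C.Kmap \<beta> i)" unfolding w lc by (rule mult[OF lc(1)])
      then have "\<exists>a \<beta>. C.level_coeffs c UNIV a \<beta> \<and> (\<forall>i<N0 c. v $ i = C.Dmap a i + C.Kmap \<beta> i)"
        using lc(1) by auto
      then show "v \<in> ?ker" using augmentation_kernel[of v] C.image_mod_ideal[OF D0, of v] v by auto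
    qed
  qed
  have "minimal_presentation_matrix ?P (hmf_module f c A0 A1 d)"
    unfolding minimal_presentation_matrix_def presentation_matrix_def dim_P
  proof (intro conjI ballI bexI impI)
    show "augmentation ` carrier_vec (N0 c) = carrier (hmf_module f c A0 A1 d)" by (rule augmentation_surj)
    show "{v \<in> carrier_vec (N0 c). augmentation v = \<zero>\<^bsub>hmf_module f c A0 A1 d\<^esub>} =
      (\<lambda>w. ?P *\<^sub>v w) ` carrier_vec (N1 c + ?l)" by (rule image)
    show "augmentation \<in> Shom (module_vec TYPE('a) (N0 c)) (hmf_module f c A0 A1 d)" by (rule augmentation_hom)
    fix w :: "'a vec" assume "w \<in> carrier_vec (N1 c + ?l)"
    then obtain a \<beta> where lc: "C.level_coeffs c UNIV a \<beta>" and w: "w = C.assemble \<sigma> ?l a \<beta>"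
      using C.assemble_surj[OF \<sigma>] by blast
    have "C.Dmap a i + C.Kmap \<beta> i \<in> ?M" for i
      unfolding C.Dmap_def C.Kmap_def using DM fM by (intro Mc(2) Mc(7) Mc(4)) auto
    then show "?P *\<^sub>v w \<in> ideal_mod ?M (module_vec TYPE('a) (N0 c))"
      unfolding w mult[OF lc] by (simp add: vec_in_ideal_mod_iff[OF M])
    assume "?P *\<^sub>v w = 0\<^sub>v (N0 c)"
    then have "vec (N0 c) (\<lambda>i. C.Dmap a i + C.Kmap \<beta> i) = 0\<^sub>v (N0 c)" unfolding w mult[OF lc] .
    then have coord: "vec (N0 c) (\<lambda>i. C.Dmap a i + C.Kmap \<beta> i) $ i = 0\<^sub>v (N0 c) $ i" for i
      by (rule arg_cong)
    have low: "C.Dmap a i + C.Kmap \<beta> i = 0" if "i < N0 c" for i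
      using coord[of i] that by simp
    have "C.Dmap a i + C.Kmap \<beta> i = 0" for i
    proof (cases "i < N0 c")
      case False
      then have "\<beta> i j = 0" for j using lc unfolding C.level_coeffs_def by blast
      then show ?thesis using False D0 by (simp add: C.Dmap_def C.Kmap_def)
    qed (rule low)
    from C.kernel_coefficients[OF M fM DM order_refl lc this]
    have "C.level_coeffs c ?M a \<beta>" by blast
    then have "\<forall>k<N1 c + ?l. w $ k \<in> ?M"
      unfolding w C.assemble_def C.level_coeffs_def by (auto split: prod.split)
    then show "w \<in> ideal_mod ?M (module_vec TYPE('a) (N1 c + ?l))"
      using vec_in_ideal_mod_iff[OF M, of w "N1 c + ?l"] by (simp add: w C.assemble_def)
  qed
  moreover have "matrix_of_hom A0 xs ys d Dm" unfolding Dm_def by (rule D_matrix)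
  moreover have "length ys = (\<Sum>p=1..c. ?b p)" using length_basis(1) unfolding N0_def .
  ultimately show ?thesis
    using K_carrier xs ys unfolding Let_def K_def[symmetric] N0_def by blast
qed

end
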